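(* Let $\mathcal{H}$ be a unitarily invariant space of pluriharmonic functions on $\mathbb{B}_d$ whose reproducing kernel has non-negative real part. Let $E \subset \partial\mathbb{B}_d$ be compact with $\operatorname{cap}_{\mathcal{H}}(E) = 0$. Then there exists $f \in \mathcal{H}$ with $\lim_{r \nearrow 1} |f(r\zeta)| = \infty$ for all $\zeta \in E$.
   Context: $\mathbb{B}_d$ is the open Euclidean unit ball of $\mathbb{C}^d$ ($d \ge 1$), with boundary sphere $\partial\mathbb{B}_d$. A unitarily invariant space of pluriharmonic functions on $\mathbb{B}_d$ is a reproducing kernel Hilbert space $\mathcal{H}$ of functions on $\mathbb{B}_d$ whose reproducing kernel has the form $$K(z,w) = \sum_{n=0}^\infty a_n \langle z,w\rangle^n + \sum_{n=1}^\infty a_{-n}\overline{\langle z,w\rangle}^n,$$ where $a_n \ge 0$ for all $n \in \mathbb{Z}$, $a_0 = 1$, and the series converges on $\mathbb{B}_d \times \mathbb{B}_d$. The $\mathcal{H}$-energy of a Borel probability measure $\mu$ on $\partial\mathbb{B}_d$ is $$\mathcal{E}(\mu) = \sup_{0 \le r < 1} \int\int K(rz,rw)\, d\mu(w)\, d\mu(z) \in [0,\infty]$$ (the double integrals are non-negative reals, increasing in $r$). For compact $E \subset \partial\mathbb{B}_d$, $\operatorname{cap}_{\mathcal{H}}(E) = \sup\{1/\mathcal{E}(\mu) : \mu$ a Borel probability measure supported on $E\}$ (with $1/\infty = 0$ and $\operatorname{cap}(\emptyset) = 0$). *)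

theory Defs
  imports "HOL-Probability.Probability"
begin

definition hinner :: "complex ^ 'd \<Rightarrow> complex ^ 'd \<Rightarrow> complex" where
  "hinner z w = (\<Sum>i\<in>UNIV. z $ i * cnj (w $ i))"

text \<open>
  Functions on a set \<open>X\<close> are represented by total functions vanishing outside \<open>X\<close>, so that
  equality of functions on \<open>X\<close> is plain equality. The inner product is linear in its first
  argument and relevant only on \<open>H\<close>.
\<close>

definition inner_product_on ::
  "('x \<Rightarrow> complex) set \<Rightarrow> (('x \<Rightarrow> complex) \<Rightarrow> ('x \<Rightarrow> complex) \<Rightarrow> complex) \<Rightarrow> bool" where
  "inner_product_on H ip \<longleftrightarrow>
     (\<forall>f\<in>H. \<forall>g\<in>H. \<forall>h\<in>H. ip (\<lambda>x. f x + g x) h = ip f h + ip g h) \<and>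
     (\<forall>c. \<forall>f\<in>H. \<forall>g\<in>H. ip (\<lambda>x. c * f x) g = c * ip f g) \<and>
     (\<forall>f\<in>H. \<forall>g\<in>H. ip g f = cnj (ip f g)) \<and>
     (\<forall>f\<in>H. 0 \<le> Re (ip f f)) \<and>
     (\<forall>f\<in>H. ip f f = 0 \<longrightarrow> f = (\<lambda>x. 0))"

definition ip_dist ::
  "(('x \<Rightarrow> complex) \<Rightarrow> ('x \<Rightarrow> complex) \<Rightarrow> complex) \<Rightarrow> ('x \<Rightarrow> complex) \<Rightarrow> ('x \<Rightarrow> complex) \<Rightarrow> real" where
  "ip_dist ip f g = sqrt (Re (ip (\<lambda>x. f x - g x) (\<lambda>x. f x - g x)))"

definition hilbert_function_space ::
  "'x set \<Rightarrow> ('x \<Rightarrow> complex) set \<Rightarrow> (('x \<Rightarrow> complex) \<Rightarrow> ('x \<Rightarrow> complex) \<Rightarrow> complex) \<Rightarrow> bool" where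
  "hilbert_function_space X H ip \<longleftrightarrow>
     (\<forall>f\<in>H. \<forall>x. x \<notin> X \<longrightarrow> f x = 0) \<and>
     (\<lambda>x. 0) \<in> H \<and>
     (\<forall>f\<in>H. \<forall>g\<in>H. (\<lambda>x. f x + g x) \<in> H) \<and>
     (\<forall>c. \<forall>f\<in>H. (\<lambda>x. c * f x) \<in> H) \<and>
     inner_product_on H ip \<and>
     (\<forall>s::nat \<Rightarrow> 'x \<Rightarrow> complex.
        (\<forall>n. s n \<in> H) \<and> (\<forall>e>0. \<exists>N. \<forall>m\<ge>N. \<forall>n\<ge>N. ip_dist ip (s m) (s n) < e) \<longrightarrow>
        (\<exists>f\<in>H. (\<lambda>n. ip_dist ip (s n) f) \<longlonglongrightarrow> 0))"

text \<open>
  The values of \<open>K\<close> outside \<open>X \<times> X\<close> are irrelevant; the kernel function \<open>K(\<cdot>,w)\<close> is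
  truncated to \<open>X\<close> according to the above representation of functions on \<open>X\<close>.
\<close>

definition reproducing_kernel_hilbert_space ::
  "'x set \<Rightarrow> ('x \<Rightarrow> complex) set \<Rightarrow> (('x \<Rightarrow> complex) \<Rightarrow> ('x \<Rightarrow> complex) \<Rightarrow> complex) \<Rightarrow>
   ('x \<Rightarrow> 'x \<Rightarrow> complex) \<Rightarrow> bool" where
  "reproducing_kernel_hilbert_space X H ip K \<longleftrightarrow>
     hilbert_function_space X H ip \<and>
     (\<forall>w\<in>X. (\<lambda>z. if z \<in> X then K z w else 0) \<in> H \<and>
        (\<forall>f\<in>H. f w = ip f (\<lambda>z. if z \<in> X then K z w else 0)))"

definition unitarily_invariant_pluriharmonic_space ::
  "(complex ^ 'd \<Rightarrow> complex) set \<Rightarrow>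
   ((complex ^ 'd \<Rightarrow> complex) \<Rightarrow> (complex ^ 'd \<Rightarrow> complex) \<Rightarrow> complex) \<Rightarrow>
   (complex ^ 'd \<Rightarrow> complex ^ 'd \<Rightarrow> complex) \<Rightarrow> bool" where
  "unitarily_invariant_pluriharmonic_space H ip K \<longleftrightarrow>
     reproducing_kernel_hilbert_space (ball 0 1) H ip K \<and>
     (\<exists>a::int \<Rightarrow> real. (\<forall>n. 0 \<le> a n) \<and> a 0 = 1 \<and>
        (\<forall>z\<in>ball 0 1. \<forall>w\<in>ball 0 1.
           summable (\<lambda>n. of_real (a (int n)) * hinner z w ^ n) \<and>
           summable (\<lambda>n. of_real (a (- int (Suc n))) * cnj (hinner z w) ^ Suc n) \<and>
           K z w = (\<Sum>n. of_real (a (int n)) * hinner z w ^ n) +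
                   (\<Sum>n. of_real (a (- int (Suc n))) * cnj (hinner z w) ^ Suc n)))"

definition sphere_probability_measure :: "(complex ^ 'd) measure \<Rightarrow> bool" where
  "sphere_probability_measure \<mu> \<longleftrightarrow>
     prob_space \<mu> \<and> sets \<mu> = sets (restrict_space borel (sphere 0 1))"

text \<open>
  For the kernels considered here the double integrals are non-negative reals, so \<open>Re\<close> is only
  the passage from \<open>complex\<close> to \<open>real\<close>.
\<close>

definition energy ::
  "(complex ^ 'd \<Rightarrow> complex ^ 'd \<Rightarrow> complex) \<Rightarrow> (complex ^ 'd) measure \<Rightarrow> ennreal" where
  "energy K \<mu> =
     (SUP r\<in>{0..<1::real}. ennreal (Re (LINT z|\<mu>. LINT w|\<mu>. K (r *\<^sub>R z) (r *\<^sub>R w))))"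

text \<open>In \<open>ennreal\<close>, \<open>1 / \<infinity> = 0\<close> and the supremum of the empty set is \<open>0\<close>.\<close>

definition capacity ::
  "(complex ^ 'd \<Rightarrow> complex ^ 'd \<Rightarrow> complex) \<Rightarrow> (complex ^ 'd) set \<Rightarrow> ennreal" where
  "capacity K E =
     (SUP \<mu>\<in>{\<mu>. sphere_probability_measure \<mu> \<and> emeasure \<mu> (sphere 0 1 - E) = 0}. 1 / energy K \<mu>)"

end

theory Submission
  imports Defs
begin

text \<open>
  For \<open>r < 1\<close> let \<open>c\<^sub>r\<close> be the infimum of the energies \<open>\<integral>\<integral> K(rz,rw)\<close> over finitely supported probability
  measures on \<open>E\<close>. These energies increase with \<open>r\<close> because the kernels \<open>\<langle>z,w\<rangle>\<^sup>n\<close> are positive definite. If \<open>c\<^sub>r\<close>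
  stayed bounded by \<open>M\<close> as \<open>r \<rightarrow> 1\<close>, a weak limit of near-minimisers would be a probability measure on
  \<open>E\<close> of energy at most \<open>M\<close>, contradicting zero capacity; hence \<open>c\<^sub>r \<rightarrow> \<infinity>\<close>.

  Fix \<open>r\<close>, write \<open>c = c\<^sub>r\<close>, and let \<open>\<mu>\<close> be a near-minimiser. First-order optimality gives
  \<open>Re \<integral> K(r\<zeta>,rw) d\<mu>(w) \<ge> c/2\<close> on \<open>E\<close>. So \<open>g(z) = (1/c) \<integral> K(z,r\<^sup>2w) d\<mu>(w)\<close> lies in \<open>H\<close>, has
  \<open>\<parallel>g\<parallel>\<^sup>2 \<le> 2/c\<close>, has non-negative real part on the ball (by positivity of \<open>Re K\<close>), and its real part
  has radial limits at least \<open>1/2\<close> on \<open>E\<close>. Summing a sequence of such \<open>g\<close> with \<open>\<parallel>g\<^sub>k\<parallel> \<le> 2\<^sup>-\<^sup>k\<close> gives \<open>f\<close>.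
\<close>

subsection \<open>Weak compactness on compact metric spaces\<close>

text \<open>
  To apply Helly's and Skorohod's theorems, which are available on the real line only, points of \<open>E\<close> are
  encoded by reals: the digits record membership in the sets of a countable basis. The digit \<open>2\<close>
  of the Cantor set is replaced by \<open>1\<close>, hence the range \<open>[0,3/2]\<close>.
\<close>

definition ternary_code :: "(nat \<Rightarrow> 'a set) \<Rightarrow> 'a \<Rightarrow> real" where
  "ternary_code U x = (\<Sum>i. indicator (U i) x * (1/3) ^ i)"

lemma summable_ternary_code: "summable (\<lambda>i. indicator (U i) x * (1/3::real) ^ i)"
  by (rule summable_comparison_test[OF _ summable_geometric[of "1/3::real"]])
     (auto simp: indicator_def intro!: exI[of _ 0])

lemma ternary_code_bounds: "0 \<le> ternary_code U x" "ternary_code U x \<le> 3/2"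
proof -
  show "0 \<le> ternary_code U x"
    unfolding ternary_code_def by (rule suminf_nonneg[OF summable_ternary_code]) auto
  have "ternary_code U x \<le> (\<Sum>i. (1/3::real) ^ i)"
    unfolding ternary_code_def
    by (rule suminf_le[OF _ summable_ternary_code]) (auto simp: indicator_def summable_geometric)
  also have "\<dots> = 3/2" by (subst suminf_geometric) auto
  finally show "ternary_code U x \<le> 3/2" .
qed

text \<open>At the first index \<open>m\<close> where the digits differ, the term has size (1/3)^m,
  while all later terms together amount to at most (1/3)^m / 2. A difference at some
  \<open>m \<le> k\<close> thus keeps the codes at least (1/3)^k / 2 apart.\<close>

lemma ternary_code_digits:
  assumes "\<bar>ternary_code U x - ternary_code U y\<bar> < (1/3) ^ k / 2" "i \<le> k"
  shows "x \<in> U i \<longleftrightarrow> y \<in> U i"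
proof (rule ccontr)
  define d where "d j = indicator (U j) x - (indicator (U j) y :: real)" for j
  assume "\<not> (x \<in> U i \<longleftrightarrow> y \<in> U i)"
  then have di: "d i \<noteq> 0" by (auto simp: d_def)
  define m where "m = (LEAST j. d j \<noteq> 0)"
  have m: "d m \<noteq> 0" "m \<le> i" "\<And>j. j < m \<Longrightarrow> d j = 0"
    unfolding m_def using LeastI[of "\<lambda>j. d j \<noteq> 0", OF di] Least_le[of "\<lambda>j. d j \<noteq> 0", OF di]
    by (auto dest: not_less_Least)
  have dle: "\<bar>d j\<bar> \<le> 1" for j by (auto simp: d_def indicator_def)
  have dm: "\<bar>d m\<bar> = 1" using m(1) by (auto simp: d_def indicator_def split: if_splits)
  have sd: "summable (\<lambda>j. d j * (1/3) ^ j)"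
    using summable_diff[OF summable_ternary_code[of U x] summable_ternary_code[of U y]]
    by (simp add: d_def algebra_simps)
  have eq: "ternary_code U x - ternary_code U y = (\<Sum>j. d j * (1/3) ^ j)"
    unfolding ternary_code_def d_def
    by (subst suminf_diff[OF summable_ternary_code summable_ternary_code]) (simp add: algebra_simps)
  also have "\<dots> = (\<Sum>j. d (j + Suc m) * (1/3) ^ (j + Suc m)) + (\<Sum>j<Suc m. d j * (1/3) ^ j)"
    by (rule suminf_split_initial_segment[OF sd])
  also have "(\<Sum>j<Suc m. d j * (1/3) ^ j) = d m * (1/3) ^ m"
    by (simp add: m(3))
  finally have e: "ternary_code U x - ternary_code U y =
      (\<Sum>j. d (j + Suc m) * (1/3) ^ (j + Suc m)) + d m * (1/3) ^ m" .
  have sg: "summable (\<lambda>j. (1/3::real) ^ (j + Suc m))"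
    using summable_geometric[of "1/3::real"] summable_iff_shift[of "\<lambda>j. (1/3::real)^j" "Suc m"] by simp
  have nle: "norm (d (j + Suc m) * (1/3) ^ (j + Suc m)) \<le> (1/3) ^ (j + Suc m)" for j
  proof -
    have "norm (d (j + Suc m) * (1/3) ^ (j + Suc m)) = \<bar>d (j + Suc m)\<bar> * (1/3) ^ (j + Suc m)"
      by (simp add: abs_mult)
    also have "\<dots> \<le> (1/3) ^ (j + Suc m)" by (rule mult_left_le_one_le[OF _ _ dle]) auto
    finally show ?thesis .
  qed
  have sa: "summable (\<lambda>j. norm (d (j + Suc m) * (1/3) ^ (j + Suc m)))"
    by (rule summable_comparison_test[OF _ sg]) (use nle in auto)
  have "\<bar>\<Sum>j. d (j + Suc m) * (1/3) ^ (j + Suc m)\<bar> \<le> (\<Sum>j. norm (d (j + Suc m) * (1/3) ^ (j + Suc m)))"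
    using summable_norm[OF sa] by simp
  also have "\<dots> \<le> (\<Sum>j. (1/3::real) ^ (j + Suc m))"
    by (rule suminf_le[OF _ sa sg]) (rule nle)
  also have "\<dots> = (1/3) ^ Suc m * (\<Sum>j. (1/3::real) ^ j)"
    using suminf_mult[OF summable_geometric[of "1/3::real"], of "(1/3) ^ Suc m"]
    by (simp add: power_add mult.commute)
  also have "\<dots> = (1/3) ^ m / 2" by (subst suminf_geometric) auto
  finally have tail: "\<bar>\<Sum>j. d (j + Suc m) * (1/3) ^ (j + Suc m)\<bar> \<le> (1/3) ^ m / 2" .
  have "\<bar>d m * (1/3) ^ m\<bar> = (1/3) ^ m"
    unfolding abs_mult dm by simp
  with tail have "\<bar>ternary_code U x - ternary_code U y\<bar> \<ge> (1/3) ^ m - (1/3) ^ m / 2"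
    unfolding e by linarith
  moreover have "(1/3::real) ^ k \<le> (1/3) ^ m"
    using m(2) assms(2) by (intro power_decreasing) auto
  ultimately show False using assms(1) by linarith
qed

text \<open>Points with equal codes lie in the same basic sets, hence in the same open sets, which
  T0 separation forbids for distinct points.\<close>

lemma inj_ternary_code:
  fixes U :: "nat \<Rightarrow> 'a::t0_space set"
  assumes "topological_basis (range U)"
  shows "inj (ternary_code U)"
proof (rule injI, rule ccontr)
  fix x y assume eq: "ternary_code U x = ternary_code U y" and "x \<noteq> y"
  then obtain V where V: "open V" "x \<in> V \<longleftrightarrow> y \<notin> V" using separation_t0[of x y] by auto
  have iff: "x \<in> U i \<longleftrightarrow> y \<in> U i" for i
    using ternary_code_digits[of U x y i i] eq by simp
  obtain B where B: "B \<subseteq> range U" "\<Union>B = V"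
    using assms V(1) by (auto simp: topological_basis_def)
  have "x \<in> W \<longleftrightarrow> y \<in> W" if "W \<in> B" for W using that B(1) iff by auto
  then have "x \<in> V \<longleftrightarrow> y \<in> V" unfolding B(2)[symmetric] by simp
  with V(2) show False by simp
qed

text \<open>The code need not be continuous and the limit of the codes need not be a code, so
  \<open>l\<close> is found by compactness. Once the codes are close, membership in a given basic
  set no longer depends on the index, and a subsequence tending to \<open>l\<close> decides it for
  the whole tail.\<close>

lemma convergent_if_ternary_code_convergent:
  fixes U :: "nat \<Rightarrow> 'a::first_countable_topology set"
  assumes U: "topological_basis (range U)" and E: "compact E" and x: "\<And>n. x n \<in> E"
    and conv: "convergent (\<lambda>n. ternary_code U (x n))"
  shows "\<exists>l\<in>E. x \<longlonglongrightarrow> l"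
proof -
  obtain l s where l: "l \<in> E" "strict_mono s" "(x \<circ> s) \<longlonglongrightarrow> l"
    using compact_imp_seq_compact[OF E] x unfolding seq_compact_def by blast
  have "x \<longlonglongrightarrow> l"
  proof (rule topological_tendstoI)
    fix V assume V: "open V" "l \<in> V"
    obtain i where i: "l \<in> U i" "U i \<subseteq> V"
      using topological_basisE[OF U V] by (metis imageE)
    have "open (U i)" using U topological_basis_open by blast
    from topological_tendstoD[OF l(3) this i(1)]
    obtain N1 where N1: "\<And>n. n \<ge> N1 \<Longrightarrow> x (s n) \<in> U i"
      by (auto simp: eventually_sequentially)
    have "Cauchy (\<lambda>n. ternary_code U (x n))"
      using conv by (simp add: Cauchy_convergent_iff)
    then obtain N2 where N2: "\<And>m n. m \<ge> N2 \<Longrightarrow> n \<ge> N2 \<Longrightarrow>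
        dist (ternary_code U (x m)) (ternary_code U (x n)) < (1/3) ^ i / 2"
      unfolding Cauchy_def by (metis half_gt_zero zero_less_divide_1_iff zero_less_numeral zero_less_power)
    have "x n \<in> V" if "n \<ge> N2" for n
    proof -
      let ?m = "max N1 N2"
      have "s ?m \<ge> N2" using seq_suble[OF l(2), of ?m] by simp
      then have "x n \<in> U i \<longleftrightarrow> x (s ?m) \<in> U i"
        using ternary_code_digits[of U "x n" "x (s ?m)" i i] N2[OF that] by (simp add: dist_real_def)
      with N1[of ?m] i(2) show ?thesis by auto
    qed
    then show "eventually (\<lambda>n. x n \<in> V) sequentially"
      by (auto simp: eventually_sequentially)
  qed
  with l(1) show ?thesis by blast
qed

text \<open>Prokhorov's theorem and Skorohod's representation in one: the laws of the codes form a
  tight family on the line, and the representing real variables are decoded to points of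
  \<open>E\<close>. Discrete measures have countable supports, which makes the decoding
  measurable.\<close>

lemma Skorohod_compact:
  fixes E :: "'a::{second_countable_topology, metric_space} set" and p :: "nat \<Rightarrow> 'a pmf"
  assumes E: "compact E" and p: "\<And>n. set_pmf (p n) \<subseteq> E"
  obtains \<phi> :: "nat \<Rightarrow> nat" and \<Omega> :: "real measure" and X Z
  where "strict_mono \<phi>" "prob_space \<Omega>"
    "\<And>n. X n \<in> borel_measurable \<Omega>" "Z \<in> borel_measurable \<Omega>"
    "\<And>n \<omega>. \<omega> \<in> space \<Omega> \<Longrightarrow> X n \<omega> \<in> E" "\<And>\<omega>. \<omega> \<in> space \<Omega> \<Longrightarrow> Z \<omega> \<in> E"
    "\<And>n. distr \<Omega> borel (X n) = distr (measure_pmf (p (\<phi> n))) borel (\<lambda>x. x)"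
    "\<And>\<omega>. \<omega> \<in> space \<Omega> \<Longrightarrow> (\<lambda>n. X n \<omega>) \<longlonglongrightarrow> Z \<omega>"
proof -
  obtain B :: "'a set set" where B: "countable B" "topological_basis B"
    using ex_countable_basis by blast
  have "B \<noteq> {}"
    using topological_basisE[OF B(2) open_UNIV UNIV_I] by blast
  define U where "U = from_nat_into B"
  have "range U = B" unfolding U_def using B(1) \<open>B \<noteq> {}\<close> by simp
  then have U: "topological_basis (range U)" using B(2) by simp
  define \<delta> where "\<delta> = ternary_code U"
  have inj: "inj \<delta>" unfolding \<delta>_def by (rule inj_ternary_code[OF U])
  define \<nu> where "\<nu> n = distr (measure_pmf (p n)) borel \<delta>" for n
  have rd: "real_distribution (\<nu> n)" for n
    unfolding \<nu>_def real_distribution_def real_distribution_axioms_def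
    by (auto intro!: prob_space.prob_space_distr measure_pmf.prob_space_axioms)
  have "measure (\<nu> n) {-1<..2} = 1" for n
  proof -
    have "\<delta> x \<in> {-1<..2}" for x
      using ternary_code_bounds[of U x] unfolding \<delta>_def by auto
    then have "\<delta> -` {-1<..2} = UNIV" by blast
    then show ?thesis unfolding \<nu>_def by (subst measure_distr) auto
  qed
  then have "tight \<nu>" unfolding tight_def using rd
    by (intro conjI allI impI exI[of _ "-1::real"] exI[of _ "2::real"]) auto
  from tight_imp_convergent_subsubsequence[OF this strict_mono_id]
  obtain \<phi> M where \<phi>: "strict_mono (\<phi>::nat\<Rightarrow>nat)" and M: "real_distribution M" "weak_conv_m (\<nu> \<circ> id \<circ> \<phi>) M"
    by blast
  have "weak_conv_m (\<lambda>n. \<nu> (\<phi> n)) M" using M(2) by (simp add: comp_def)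
  from Skorohod[OF rd M(1) this]
  obtain \<Omega> :: "real measure" and Y Y0 where
    ps: "prob_space \<Omega>" and Y[measurable]: "\<And>n. Y n \<in> borel_measurable \<Omega>"
    and dY: "\<And>n. distr \<Omega> borel (Y n) = \<nu> (\<phi> n)"
    and lim: "\<And>\<omega>. \<omega> \<in> space \<Omega> \<Longrightarrow> (\<lambda>n. Y n \<omega>) \<longlonglongrightarrow> Y0 \<omega>" by blast
  define S where "S n = set_pmf (p (\<phi> n))" for n
  have SE: "S n \<subseteq> E" "countable (\<delta> ` S n)" for n unfolding S_def using p by auto
  have Sm[measurable]: "\<delta> ` S n \<in> sets borel" for n
    by (rule sets.countable[OF _ SE(2)]) auto
  obtain e0 where e0: "e0 \<in> E" using SE(1)[of 0] set_pmf_not_empty[of "p (\<phi> 0)"] by (auto simp: S_def)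
  \<comment> \<open>The decoder differs from the constant \<open>e0\<close> only on a countable set,
    hence is Borel; \<open>e0\<close> serves as a default point of \<open>E\<close>.\<close>
  define g where "g n y = (if y \<in> \<delta> ` S n then inv \<delta> y else e0)" for n y
  have gm[measurable]: "g n \<in> borel_measurable borel" for n
    by (rule measurable_discrete_difference[of "\<lambda>_. e0" _ _ "\<delta> ` S n"])
       (auto simp: g_def SE intro: sets.countable)
  have g_inv: "g n (\<delta> x) = x" if "x \<in> S n" for n x
    using that inj by (simp add: g_def)
  have gE: "g n y \<in> E" for n y
    using SE(1)[of n] e0 inj by (auto simp: g_def)
  \<comment> \<open>\<open>D\<close> has full probability, being a countable intersection of almost
    sure events. Outside \<open>D\<close> every \<open>X n\<close> is set to \<open>e0\<close>, so
    that the sequence converges in \<open>E\<close> at every point of the space.\<close>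
  define D where "D = {\<omega> \<in> space \<Omega>. \<forall>n. Y n \<omega> \<in> \<delta> ` S n}"
  have Dm[measurable]: "D \<in> sets \<Omega>" unfolding D_def by measurable
  define X where "X n \<omega> = (if \<omega> \<in> D then g n (Y n \<omega>) else e0)" for n \<omega>
  have Xm[measurable]: "X n \<in> borel_measurable \<Omega>" for n
    unfolding X_def by measurable
  have XE: "X n \<omega> \<in> E" for n \<omega> by (simp add: X_def gE e0)
  have "AE \<omega> in \<Omega>. Y n \<omega> \<in> \<delta> ` S n" for n
  proof -
    have "AE y in \<nu> (\<phi> n). y \<in> \<delta> ` S n"
      unfolding \<nu>_def S_def by (subst AE_distr_iff) (auto simp: AE_measure_pmf_iff Sm[unfolded S_def])
    then show ?thesis
      unfolding dY[symmetric] by (subst (asm) AE_distr_iff) auto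
  qed
  then have aeD: "AE \<omega> in \<Omega>. \<omega> \<in> D"
    using AE_space by (auto simp: D_def AE_all_countable)
  have dX: "distr \<Omega> borel (X n) = distr (measure_pmf (p (\<phi> n))) borel (\<lambda>x. x)" for n
  proof -
    have "distr \<Omega> borel (X n) = distr \<Omega> borel (\<lambda>\<omega>. g n (Y n \<omega>))"
      by (rule distr_cong_AE) (use aeD in \<open>auto simp: X_def\<close>)
    also have "\<dots> = distr (distr \<Omega> borel (Y n)) borel (g n)"
      by (subst distr_distr) (auto simp: comp_def)
    also have "\<dots> = distr (measure_pmf (p (\<phi> n))) borel (\<lambda>x. g n (\<delta> x))"
      unfolding dY \<nu>_def by (subst distr_distr) (auto simp: comp_def)
    also have "\<dots> = distr (measure_pmf (p (\<phi> n))) borel (\<lambda>x. x)"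
      by (rule distr_cong_AE) (auto simp: AE_measure_pmf_iff g_inv S_def)
    finally show ?thesis .
  qed
  have "\<exists>l\<in>E. (\<lambda>n. X n \<omega>) \<longlonglongrightarrow> l" if "\<omega> \<in> space \<Omega>" for \<omega>
  proof (cases "\<omega> \<in> D")
    case True
    have "\<delta> (X n \<omega>) = Y n \<omega>" for n
    proof -
      have "Y n \<omega> \<in> \<delta> ` S n" using True by (auto simp: D_def)
      then obtain x where "x \<in> S n" "Y n \<omega> = \<delta> x" by blast
      then show ?thesis using True g_inv by (simp add: X_def)
    qed
    then have "convergent (\<lambda>n. ternary_code U (X n \<omega>))"
      using lim[OF that] by (auto simp: \<delta>_def convergent_def)
    from convergent_if_ternary_code_convergent[OF U E XE this] show ?thesis .
  next
    case False
    then show ?thesis using e0 by (auto simp: X_def)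
  qed
  then obtain Z where Z: "\<And>\<omega>. \<omega> \<in> space \<Omega> \<Longrightarrow> Z \<omega> \<in> E \<and> (\<lambda>n. X n \<omega>) \<longlonglongrightarrow> Z \<omega>"
    by metis
  have Zm: "Z \<in> borel_measurable \<Omega>"
    by (rule borel_measurable_LIMSEQ_metric[of X, OF Xm]) (use Z in auto)
  show thesis
    by (rule that[OF \<phi> ps Xm Zm XE _ dX]) (use Z in auto)
qed

subsection \<open>Reproducing kernel Hilbert spaces\<close>

locale rkhs =
  fixes X :: "'x set" and H ip K
  assumes rkhs: "reproducing_kernel_hilbert_space X H ip K"
begin

definition kernel_fun :: "'x \<Rightarrow> 'x \<Rightarrow> complex" where
  "kernel_fun w = (\<lambda>z. if z \<in> X then K z w else 0)"

definition norm_of :: "('x \<Rightarrow> complex) \<Rightarrow> real" where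
  "norm_of f = sqrt (Re (ip f f))"

lemma hilbert_function_space_H: "hilbert_function_space X H ip"
  using rkhs by (simp add: reproducing_kernel_hilbert_space_def)

lemma inner_product_on_H: "inner_product_on H ip"
  using hilbert_function_space_H unfolding hilbert_function_space_def by blast

lemma kernel_fun_mem: "w \<in> X \<Longrightarrow> kernel_fun w \<in> H"
  and reproducing: "w \<in> X \<Longrightarrow> f \<in> H \<Longrightarrow> ip f (kernel_fun w) = f w"
  using rkhs by (auto simp: reproducing_kernel_hilbert_space_def kernel_fun_def)

lemma zero_mem: "(\<lambda>x. 0) \<in> H"
  and add_mem: "f \<in> H \<Longrightarrow> g \<in> H \<Longrightarrow> (\<lambda>x. f x + g x) \<in> H"
  and scale_mem: "f \<in> H \<Longrightarrow> (\<lambda>x. c * f x) \<in> H"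
  using hilbert_function_space_H unfolding hilbert_function_space_def by blast+

lemma diff_mem: "f \<in> H \<Longrightarrow> g \<in> H \<Longrightarrow> (\<lambda>x. f x - g x) \<in> H"
  using add_mem[of f "\<lambda>x. (-1) * g x"] scale_mem[of g "-1"] by simp

lemma ip_add_left: "f \<in> H \<Longrightarrow> g \<in> H \<Longrightarrow> h \<in> H \<Longrightarrow> ip (\<lambda>x. f x + g x) h = ip f h + ip g h"
  and ip_scale_left: "f \<in> H \<Longrightarrow> h \<in> H \<Longrightarrow> ip (\<lambda>x. c * f x) h = c * ip f h"
  and ip_commute: "f \<in> H \<Longrightarrow> g \<in> H \<Longrightarrow> ip g f = cnj (ip f g)"
  and ip_nonneg: "f \<in> H \<Longrightarrow> 0 \<le> Re (ip f f)"
  and ip_eq_0: "f \<in> H \<Longrightarrow> ip f f = 0 \<Longrightarrow> f = (\<lambda>x. 0)"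
  using inner_product_on_H unfolding inner_product_on_def by blast+

lemma ip_add_right:
  assumes "f \<in> H" "g \<in> H" "h \<in> H"
  shows "ip h (\<lambda>x. f x + g x) = ip h f + ip h g"
  using assms by (simp add: ip_commute[of _ h] add_mem ip_add_left)

lemma ip_scale_right:
  assumes "f \<in> H" "h \<in> H"
  shows "ip h (\<lambda>x. c * f x) = cnj c * ip h f"
  using assms by (simp add: ip_commute[of _ h] scale_mem ip_scale_left)

lemma ip_zero_left: "h \<in> H \<Longrightarrow> ip (\<lambda>x. 0) h = 0"
  using ip_scale_left[of "\<lambda>x. 0" h 0] zero_mem by simp

lemma ip_self: "f \<in> H \<Longrightarrow> ip f f = of_real (Re (ip f f))"
  using ip_commute[of f f] by (simp add: complex_eq_iff)

lemma norm_of_nonneg: "0 \<le> norm_of f" if "f \<in> H"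
  using ip_nonneg[OF that] by (simp add: norm_of_def)

lemma norm_of_sq: "f \<in> H \<Longrightarrow> (norm_of f)\<^sup>2 = Re (ip f f)"
  by (simp add: norm_of_def ip_nonneg)

lemma ip_dist_norm_of: "ip_dist ip f g = norm_of (\<lambda>x. f x - g x)"
  by (simp add: ip_dist_def norm_of_def)

lemma lincomb_mem:
  assumes "\<And>i. i \<in> I \<Longrightarrow> f i \<in> H"
  shows "(\<lambda>x. \<Sum>i\<in>I. c i * f i x) \<in> H"
  using assms by (induction I rule: infinite_finite_induct) (auto intro!: zero_mem add_mem scale_mem)

lemma ip_lincomb_left:
  assumes "\<And>i. i \<in> I \<Longrightarrow> f i \<in> H" "h \<in> H"
  shows "ip (\<lambda>x. \<Sum>i\<in>I. c i * f i x) h = (\<Sum>i\<in>I. c i * ip (f i) h)"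
  using assms
proof (induction I rule: infinite_finite_induct)
  case (insert i I)
  then show ?case
    by (simp add: ip_add_left[OF scale_mem lincomb_mem] ip_scale_left)
qed (auto simp: ip_zero_left)

lemma ip_lincomb_right:
  assumes "\<And>i. i \<in> I \<Longrightarrow> f i \<in> H" "h \<in> H"
  shows "ip h (\<lambda>x. \<Sum>i\<in>I. c i * f i x) = (\<Sum>i\<in>I. cnj (c i) * ip h (f i))"
proof -
  have "ip h (\<lambda>x. \<Sum>i\<in>I. c i * f i x) = cnj (\<Sum>i\<in>I. c i * ip (f i) h)"
    using assms by (subst ip_commute[of _ h]) (auto intro!: lincomb_mem simp: ip_lincomb_left)
  also have "\<dots> = (\<Sum>i\<in>I. cnj (c i) * ip h (f i))"
    unfolding cnj_sum by (rule sum.cong) (use assms in \<open>auto simp: ip_commute[of _ h]\<close>)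
  finally show ?thesis .
qed

lemma Cauchy_Schwarz:
  assumes f: "f \<in> H" and g: "g \<in> H"
  shows "cmod (ip f g) \<le> norm_of f * norm_of g"
proof (cases "ip g g = 0")
  case True
  have "g = (\<lambda>x. 0)" by (rule ip_eq_0[OF g True])
  then have "ip f g = 0" using ip_commute[OF zero_mem f] ip_zero_left[OF f] by simp
  then show ?thesis using f g by (simp add: norm_of_nonneg)
next
  case False
  define A where "A = Re (ip f f)"
  define B where "B = Re (ip g g)"
  define c where "c = ip f g"
  have AB: "ip f f = of_real A" "ip g g = of_real B" "ip g f = cnj c"
    unfolding A_def B_def c_def by (rule ip_self[OF f], rule ip_self[OF g], rule ip_commute[OF f g])
  have Bpos: "B > 0"
    using False AB(2) ip_nonneg[OF g] unfolding B_def[symmetric] by (cases "B = 0") auto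
  \<comment> \<open>Up to the factor \<open>B\<close>, this is the component of \<open>f\<close>
    orthogonal to \<open>g\<close>; its squared norm is non-negative.\<close>
  let ?u = "\<lambda>x. of_real B * f x + (- c) * g x"
  have "ip ?u ?u = of_real B * of_real B * of_real A - of_real B * (c * cnj c)"
    by (simp only: ip_add_left ip_add_right ip_scale_left ip_scale_right scale_mem add_mem f g AB
        c_def[symmetric]) (simp add: algebra_simps)
  also have "\<dots> = of_real (B * (A * B - (cmod c)\<^sup>2))"
    unfolding complex_norm_square[symmetric] of_real_mult[symmetric] of_real_diff[symmetric]
    by (rule arg_cong[of _ _ of_real]) (simp add: algebra_simps)
  finally have "0 \<le> B * (A * B - (cmod c)\<^sup>2)"
    using ip_nonneg[OF add_mem[OF scale_mem[OF f] scale_mem[OF g]], of "of_real B" "- c"]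
    by (simp only: Re_complex_of_real)
  then have "(cmod c)\<^sup>2 \<le> A * B" using Bpos by (simp add: zero_le_mult_iff)
  then have "cmod c \<le> sqrt (A * B)" by (rule real_le_rsqrt)
  then show ?thesis by (simp add: c_def A_def B_def norm_of_def real_sqrt_mult)
qed

lemma norm_of_triangle:
  assumes f: "f \<in> H" and g: "g \<in> H"
  shows "norm_of (\<lambda>x. f x + g x) \<le> norm_of f + norm_of g"
proof -
  have "Re (ip (\<lambda>x. f x + g x) (\<lambda>x. f x + g x)) = Re (ip f f) + Re (ip g g) + 2 * Re (ip f g)"
    using ip_commute[OF f g] by (simp add: ip_add_left ip_add_right add_mem f g)
  also have "\<dots> \<le> (norm_of f)\<^sup>2 + (norm_of g)\<^sup>2 + 2 * (norm_of f * norm_of g)"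
    using Cauchy_Schwarz[OF f g] complex_Re_le_cmod[of "ip f g"] by (simp add: norm_of_sq f g)
  also have "\<dots> = (norm_of f + norm_of g)\<^sup>2" by (simp add: power2_sum)
  finally show ?thesis
    unfolding norm_of_def[of "\<lambda>x. f x + g x"]
    by (intro real_le_lsqrt) (auto simp: norm_of_nonneg f g)
qed

lemma norm_of_scale: "f \<in> H \<Longrightarrow> norm_of (\<lambda>x. c * f x) = cmod c * norm_of f"
proof -
  assume f: "f \<in> H"
  have "ip (\<lambda>x. c * f x) (\<lambda>x. c * f x) = (c * cnj c) * ip f f"
    by (simp add: ip_scale_left ip_scale_right scale_mem f)
  also have "\<dots> = of_real ((cmod c)\<^sup>2 * Re (ip f f))"
    using ip_self[OF f] complex_norm_square[of c] by (metis of_real_mult)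
  finally show ?thesis by (simp add: norm_of_def real_sqrt_mult)
qed

lemma norm_of_sum:
  assumes "finite I" "\<And>i. i \<in> I \<Longrightarrow> f i \<in> H"
  shows "norm_of (\<lambda>x. \<Sum>i\<in>I. f i x) \<le> (\<Sum>i\<in>I. norm_of (f i))"
  using assms
proof (induction I rule: finite_induct)
  case empty
  then show ?case by (simp add: norm_of_def ip_zero_left zero_mem)
next
  case (insert i I)
  have "(\<lambda>x. \<Sum>i\<in>I. f i x) \<in> H" using lincomb_mem[of I f "\<lambda>_. 1"] insert by simp
  then show ?case using insert norm_of_triangle[of "f i" "\<lambda>x. \<Sum>i\<in>I. f i x"] by simp
qed

text \<open>Completeness gives a limit in norm. It is also the pointwise limit, because evaluation
  at \<open>x\<close> is the inner product with \<open>kernel_fun x\<close> and hence bounded by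
  Cauchy-Schwarz.\<close>

lemma summable_series:
  assumes f: "\<And>i. f i \<in> H" and s: "summable (\<lambda>i::nat. norm_of (f i))"
  shows "\<exists>F\<in>H. \<forall>x\<in>X. (\<lambda>i. f i x) sums F x"
proof -
  define S where "S n = (\<lambda>x. \<Sum>i<n. f i x)" for n
  define P where "P n = (\<Sum>i<n. norm_of (f i))" for n
  have SH: "S n \<in> H" for n unfolding S_def using lincomb_mem[of "{..<n}" f "\<lambda>_. 1"] f by simp
  have d1: "ip_dist ip (S n) (S m) \<le> \<bar>P n - P m\<bar>" if "m \<le> n" for m n
  proof -
    have "S n x - S m x = (\<Sum>i\<in>{m..<n}. f i x)" for x
      unfolding S_def using sum_diff_nat_ivl[of 0 m n "\<lambda>i. f i x"] that
      by (simp add: lessThan_atLeast0)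
    then have "ip_dist ip (S n) (S m) = norm_of (\<lambda>x. \<Sum>i\<in>{m..<n}. f i x)"
      by (simp add: ip_dist_norm_of)
    also have "\<dots> \<le> (\<Sum>i\<in>{m..<n}. norm_of (f i))" by (rule norm_of_sum) (auto simp: f)
    also have "\<dots> = P n - P m"
      unfolding P_def using sum_diff_nat_ivl[of 0 m n "\<lambda>i. norm_of (f i)"] that
      by (simp add: lessThan_atLeast0)
    finally show ?thesis by simp
  qed
  have comm: "ip_dist ip (S n) (S m) = ip_dist ip (S m) (S n)" for m n
    using norm_of_scale[OF diff_mem[OF SH[of n] SH[of m]], of "-1"]
    by (simp add: ip_dist_norm_of)
  have d: "ip_dist ip (S m) (S n) \<le> \<bar>P m - P n\<bar>" for m n
    using d1[of m n] d1[of n m] comm[of m n] by (cases "m \<le> n") (auto simp: abs_minus_commute)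
  have "Cauchy P" unfolding P_def using s by (simp add: summable_iff_convergent Cauchy_convergent_iff)
  then have "\<forall>e>0. \<exists>N. \<forall>m\<ge>N. \<forall>n\<ge>N. ip_dist ip (S m) (S n) < e"
    unfolding Cauchy_def dist_real_def using d by (meson le_less_trans)
  moreover have "\<forall>s. (\<forall>n. s n \<in> H) \<and> (\<forall>e>0. \<exists>N. \<forall>m\<ge>N. \<forall>n\<ge>N. ip_dist ip (s m) (s n) < e) \<longrightarrow>
        (\<exists>f\<in>H. (\<lambda>n. ip_dist ip (s n) f) \<longlonglongrightarrow> 0)"
    using hilbert_function_space_H unfolding hilbert_function_space_def by blast
  ultimately obtain F where F: "F \<in> H" "(\<lambda>n. ip_dist ip (S n) F) \<longlonglongrightarrow> 0"
    using SH by blast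
  have "(\<lambda>i. f i x) sums F x" if x: "x \<in> X" for x
  proof -
    have le: "norm (S n x - F x) \<le> ip_dist ip (S n) F * norm_of (kernel_fun x)" for n
      using Cauchy_Schwarz[OF diff_mem[OF SH[of n] F(1)] kernel_fun_mem[OF x]]
        reproducing[OF x diff_mem[OF SH[of n] F(1)]]
      by (simp add: ip_dist_norm_of)
    have "(\<lambda>n. S n x - F x) \<longlonglongrightarrow> 0"
      by (rule Lim_null_comparison[OF always_eventually tendsto_mult_left_zero[OF F(2)]])
         (use le in auto)
    then show ?thesis unfolding sums_def S_def by (simp add: LIM_zero_iff)
  qed
  with F(1) show ?thesis by blast
qed

text \<open>First-order optimality for an approximate minimiser \<open>h\<close> of the norm on a convex set: moving from
  \<open>h\<close> towards \<open>k\<close> cannot decrease the squared norm below \<open>c\<close>.\<close>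

lemma approximate_minimizer:
  assumes h: "h \<in> H" and k: "k \<in> H" and t: "0 < t" "t * B \<le> 1/2" "t < 1"
    and B: "Re (ip k k) \<le> B" and c: "1 \<le> c" "c \<le> Re (ip h h)" and hc: "Re (ip h h) \<le> c + t / 2"
    and mix: "c \<le> Re (ip (\<lambda>x. of_real (1 - t) * h x + of_real t * k x)
                        (\<lambda>x. of_real (1 - t) * h x + of_real t * k x))"
  shows "c / 2 \<le> Re (ip h k)"
proof (rule ccontr)
  define A where "A = Re (ip h h)"
  define R where "R = Re (ip h k)"
  define B' where "B' = Re (ip k k)"
  assume "\<not> c / 2 \<le> Re (ip h k)"
  then have R: "2 * R < A" using c(2) by (simp add: R_def A_def)
  have "ip (\<lambda>x. of_real (1 - t) * h x + of_real t * k x) (\<lambda>x. of_real (1 - t) * h x + of_real t * k x)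
    = of_real ((1 - t)\<^sup>2) * ip h h + of_real (t * (1 - t)) * (ip h k + cnj (ip h k)) + of_real (t\<^sup>2) * ip k k"
    by (simp only: ip_add_left ip_add_right ip_scale_left ip_scale_right scale_mem add_mem h k
        ip_commute[OF h k]) (simp add: power2_eq_square algebra_simps)
  then have "c \<le> (1 - t)\<^sup>2 * A + t * (1 - t) * (2 * R) + t\<^sup>2 * B'"
    using mix by (simp add: A_def R_def B'_def)
  moreover have "t * (1 - t) * (2 * R) < t * (1 - t) * A"
    using R t by (intro mult_strict_left_mono) auto
  moreover have "t\<^sup>2 * B' \<le> t / 2"
  proof -
    have "t * (t * B') \<le> t * (t * B)" using t B by (intro mult_left_mono) (auto simp: B'_def)
    also have "\<dots> \<le> t * (1/2)" using t by (intro mult_left_mono) auto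
    finally show ?thesis by (simp add: power2_eq_square mult.assoc)
  qed
  \<comment> \<open>Since \<open>2 * R < A\<close>, the first two terms stay below
    \<open>(1 - t) * A\<close>, and the quadratic term costs at most \<open>t / 2\<close>. With the
    slack \<open>A \<le> c + t / 2\<close> this gives \<open>t * A < t\<close>, against
    \<open>1 \<le> c\<close> and \<open>c \<le> A\<close>.\<close>
  ultimately have "c < (1 - t) * A + t / 2"
    by (simp add: power2_eq_square algebra_simps)
  then have "t * A < t * 1" using hc unfolding A_def[symmetric] by (simp add: algebra_simps)
  then have "A < 1" using t by simp
  with c show False unfolding A_def by simp
qed

end

subsection \<open>Unitarily invariant kernels\<close>

lemma hinner_scaleR: "hinner (r *\<^sub>R z) (s *\<^sub>R w) = of_real (r * s) * hinner z w"
  by (simp add: hinner_def sum_distrib_left scaleR_conv_of_real[where 'a = complex] mult_ac)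

lemma hinner_scaleR_left: "hinner (r *\<^sub>R z) w = of_real r * hinner z w"
  using hinner_scaleR[of r z 1 w] by simp

lemma hinner_scaleR_right: "hinner z (r *\<^sub>R w) = of_real r * hinner z w"
  using hinner_scaleR[of 1 z r w] by simp

lemma norm_hinner_le: "cmod (hinner z w) \<le> norm z * norm w"
proof -
  have "cmod (hinner z w) \<le> (\<Sum>i\<in>UNIV. \<bar>cmod (z $ i)\<bar> * \<bar>cmod (w $ i)\<bar>)"
    unfolding hinner_def by (rule sum_norm_le) (simp add: norm_mult)
  also have "\<dots> \<le> norm z * norm w"
    unfolding norm_vec_def by (rule L2_set_mult_ineq)
  finally show ?thesis .
qed

lemma hinner_self: "hinner z z = of_real ((norm z)\<^sup>2)"
  by (simp add: hinner_def norm_vec_def L2_set_def sum_nonneg complex_norm_square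
      flip: of_real_power)

lemma continuous_on_hinner [continuous_intros]:
  "continuous_on S f \<Longrightarrow> continuous_on S g \<Longrightarrow> continuous_on S (\<lambda>x. hinner (f x) (g x))"
  unfolding hinner_def by (intro continuous_intros)

lemma tendsto_hinner [tendsto_intros]:
  "(f \<longlongrightarrow> a) F \<Longrightarrow> (g \<longlongrightarrow> b) F \<Longrightarrow> ((\<lambda>x. hinner (f x) (g x)) \<longlongrightarrow> hinner a b) F"
  unfolding hinner_def by (intro tendsto_intros)

lemma borel_measurable_hinner [measurable (raw)]:
  assumes "f \<in> borel_measurable M" "g \<in> borel_measurable M"
  shows "(\<lambda>x. hinner (f x) (g x)) \<in> borel_measurable M"
  by (rule borel_measurable_continuous_Pair[OF assms]) (intro continuous_intros)

text \<open>Schur product argument by induction on \<open>n\<close>: one factor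
  \<open>hinner (z i) (z j)\<close> is expanded over the coordinates \<open>l\<close>, and each
  coordinate is absorbed into new coefficients \<open>c i * z i $ l\<close>. Hence the induction
  runs over arbitrary complex \<open>c\<close>.\<close>

lemma hinner_power_pos_def:
  fixes z :: "'a \<Rightarrow> complex ^ 'd" and c :: "'a \<Rightarrow> complex"
  shows "0 \<le> Re (\<Sum>i\<in>S. \<Sum>j\<in>S. c i * cnj (c j) * hinner (z i) (z j) ^ n)"
proof (induction n arbitrary: c)
  case 0
  have "(\<Sum>i\<in>S. \<Sum>j\<in>S. c i * cnj (c j)) = (\<Sum>i\<in>S. c i) * cnj (\<Sum>i\<in>S. c i)"
    by (simp add: sum_product cnj_sum)
  also have "\<dots> = of_real ((cmod (\<Sum>i\<in>S. c i))\<^sup>2)" by (rule complex_norm_square[symmetric])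
  finally show ?case by (simp del: of_real_power)
next
  case (Suc n)
  have "(\<Sum>i\<in>S. \<Sum>j\<in>S. c i * cnj (c j) * hinner (z i) (z j) ^ Suc n)
    = (\<Sum>i\<in>S. \<Sum>j\<in>S. \<Sum>l\<in>UNIV. (c i * z i $ l) * cnj (c j * z j $ l) * hinner (z i) (z j) ^ n)"
    by (intro sum.cong refl)
      (simp add: hinner_def[of "z i" "z j" for i j] sum_distrib_left sum_distrib_right mult_ac)
  also have "\<dots> = (\<Sum>i\<in>S. \<Sum>l\<in>UNIV. \<Sum>j\<in>S. (c i * z i $ l) * cnj (c j * z j $ l) * hinner (z i) (z j) ^ n)"
    by (intro sum.cong refl sum.swap)
  also have "\<dots> = (\<Sum>l\<in>UNIV. \<Sum>i\<in>S. \<Sum>j\<in>S. (c i * z i $ l) * cnj (c j * z j $ l) * hinner (z i) (z j) ^ n)"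
    by (rule sum.swap)
  also have "0 \<le> Re \<dots>"
    unfolding Re_sum[of _ UNIV] by (rule sum_nonneg) (rule Suc.IH)
  finally show ?case .
qed

lemma Re_complex_of_real_mult: "Re (of_real x * w) = x * Re w"
  by simp

section \<open>Kernels as functions of the inner product\<close>

locale radial_series =
  fixes \<alpha> \<beta> :: "nat \<Rightarrow> real"
  assumes nonneg: "0 \<le> \<alpha> n" "0 \<le> \<beta> n"
    and summable: "cmod t < 1 \<Longrightarrow> summable (\<lambda>n. of_real (\<alpha> n) * t ^ n)"
      "cmod t < 1 \<Longrightarrow> summable (\<lambda>n. of_real (\<beta> n) * t ^ n)"
begin

text \<open>The kernel in the variable t = <z,w>: \<alpha> carries the holomorphic part and \<beta>
  the antiholomorphic one.\<close>

definition \<kappa> :: "complex \<Rightarrow> complex" where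
  "\<kappa> t = (\<Sum>n. of_real (\<alpha> n) * t ^ n) + (\<Sum>n. of_real (\<beta> n) * cnj t ^ n)"

lemma borel_measurable_\<kappa> [measurable]: "\<kappa> \<in> borel_measurable borel"
proof -
  have [measurable]: "cnj \<in> borel_measurable borel"
    by (intro borel_measurable_continuous_onI continuous_intros)
  show ?thesis unfolding \<kappa>_def by measurable
qed

lemma isCont_\<kappa>:
  assumes "cmod t < 1"
  shows "isCont \<kappa> t"
proof -
  obtain \<rho> where \<rho>: "cmod t < \<rho>" "\<rho> < 1" using assms dense by blast
  then have "0 < \<rho>" using norm_ge_zero[of t] by linarith
  with \<rho> have r: "cmod (of_real \<rho>) < 1" "cmod t < cmod (of_real \<rho>)" by auto
  have "isCont (\<lambda>t. \<Sum>n. of_real (\<alpha> n) * t ^ n) t"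
    by (rule isCont_powser[OF summable(1)[OF r(1)] r(2)])
  moreover have "isCont (\<lambda>t. \<Sum>n. of_real (\<beta> n) * cnj t ^ n) t"
  proof (rule isCont_o2[where f = cnj])
    show "isCont cnj t" by (intro continuous_intros)
    show "isCont (\<lambda>t. \<Sum>n. of_real (\<beta> n) * t ^ n) (cnj t)"
      by (rule isCont_powser[OF summable(2)[OF r(1)]]) (use r in simp)
  qed
  ultimately show ?thesis unfolding \<kappa>_def by (rule isCont_add)
qed

lemma \<kappa>_bounded:
  assumes "\<rho> < 1"
  obtains B where "\<And>t. cmod t \<le> \<rho> \<Longrightarrow> cmod (\<kappa> t) \<le> B"
proof -
  have "continuous_on (cball 0 \<rho>) \<kappa>"
    by (intro continuous_at_imp_continuous_on ballI isCont_\<kappa>) (use assms in auto)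
  then have "bounded (\<kappa> ` cball 0 \<rho>)"
    by (intro compact_imp_bounded compact_continuous_image) auto
  then obtain B where "\<forall>x\<in>cball 0 \<rho>. cmod (\<kappa> x) \<le> B" by (auto simp: bounded_iff)
  then show thesis using that[of B] by auto
qed

text \<open>With real coefficients, a power of \<open>hinner\<close> and its conjugate contribute
  the same real part. So the form is the series of
  \<open>(\<alpha> n + \<beta> n) * r ^ n * P n\<close>, where \<open>P n \<ge> 0\<close> by
  positive definiteness of the powers, and every term increases with \<open>r\<close>.\<close>

lemma \<kappa>_quadratic_form_mono:
  fixes z :: "'a \<Rightarrow> complex ^ 'd" and c :: "'a \<Rightarrow> real"
  assumes z: "\<And>i. i \<in> S \<Longrightarrow> norm (z i) \<le> 1" and r: "0 \<le> r" "r \<le> r'" "r' < 1"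
  shows "Re (\<Sum>i\<in>S. \<Sum>j\<in>S. of_real (c i * c j) * \<kappa> (of_real r * hinner (z i) (z j)))
       \<le> Re (\<Sum>i\<in>S. \<Sum>j\<in>S. of_real (c i * c j) * \<kappa> (of_real r' * hinner (z i) (z j)))"
proof -
  define P where "P n = Re (\<Sum>i\<in>S. \<Sum>j\<in>S. of_real (c i * c j) * hinner (z i) (z j) ^ n)" for n
  have P0: "0 \<le> P n" for n
    using hinner_power_pos_def[where S = S and c = "\<lambda>i. of_real (c i)" and z = z and n = n]
    unfolding P_def by (simp only: complex_cnj_complex_of_real of_real_mult)
  have sums: "(\<lambda>n. (\<alpha> n + \<beta> n) * r ^ n * P n) sums
      Re (\<Sum>i\<in>S. \<Sum>j\<in>S. of_real (c i * c j) * \<kappa> (of_real r * hinner (z i) (z j)))"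
    if r: "0 \<le> r" "r < 1" for r
  proof -
    have "(\<lambda>n. of_real (\<alpha> n) * (of_real r * hinner (z i) (z j)) ^ n +
        of_real (\<beta> n) * cnj (of_real r * hinner (z i) (z j)) ^ n) sums \<kappa> (of_real r * hinner (z i) (z j))"
      if "i \<in> S" "j \<in> S" for i j
    proof -
      have "cmod (hinner (z i) (z j)) \<le> 1 * 1"
        using norm_hinner_le[of "z i" "z j"] mult_mono[OF z[OF that(1)] z[OF that(2)]] by simp
      then have "cmod (of_real r * hinner (z i) (z j)) \<le> r"
        using r by (simp add: norm_mult mult_left_le)
      then have "cmod (of_real r * hinner (z i) (z j)) < 1" using r by simp
      then show ?thesis unfolding \<kappa>_def
        by (intro sums_add summable_sums summable) (simp_all del: complex_cnj_mult)
    qed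
    then have "(\<lambda>n. \<Sum>i\<in>S. \<Sum>j\<in>S. of_real (c i * c j) *
        (of_real (\<alpha> n) * (of_real r * hinner (z i) (z j)) ^ n +
        of_real (\<beta> n) * cnj (of_real r * hinner (z i) (z j)) ^ n)) sums
        (\<Sum>i\<in>S. \<Sum>j\<in>S. of_real (c i * c j) * \<kappa> (of_real r * hinner (z i) (z j)))"
      by (intro sums_sum sums_mult)
    then have "(\<lambda>n. Re (\<Sum>i\<in>S. \<Sum>j\<in>S. of_real (c i * c j) *
        (of_real (\<alpha> n) * (of_real r * hinner (z i) (z j)) ^ n +
        of_real (\<beta> n) * cnj (of_real r * hinner (z i) (z j)) ^ n))) sums
        Re (\<Sum>i\<in>S. \<Sum>j\<in>S. of_real (c i * c j) * \<kappa> (of_real r * hinner (z i) (z j)))"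
      by (rule sums_Re)
    also have "(\<lambda>n. Re (\<Sum>i\<in>S. \<Sum>j\<in>S. of_real (c i * c j) *
        (of_real (\<alpha> n) * (of_real r * hinner (z i) (z j)) ^ n +
        of_real (\<beta> n) * cnj (of_real r * hinner (z i) (z j)) ^ n))) = (\<lambda>n. (\<alpha> n + \<beta> n) * r ^ n * P n)"
    proof
      fix n
      have *: "Re (of_real (c i * c j) * (of_real (\<alpha> n) * (of_real r * t) ^ n +
          of_real (\<beta> n) * cnj (of_real r * t) ^ n)) = (\<alpha> n + \<beta> n) * r ^ n * Re (of_real (c i * c j) * t ^ n)"
        for i j t
      proof -
        have "of_real (c i * c j) * (of_real (\<alpha> n) * (of_real r * t) ^ n +
            of_real (\<beta> n) * cnj (of_real r * t) ^ n) = of_real (c i * c j * r ^ n) *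
            (of_real (\<alpha> n) * t ^ n + of_real (\<beta> n) * cnj (t ^ n))"
          by (simp add: power_mult_distrib) (simp add: algebra_simps)
        then show ?thesis by (simp only: Re_complex_of_real_mult plus_complex.sel cnj.sel) (simp only: algebra_simps)
      qed
      show "Re (\<Sum>i\<in>S. \<Sum>j\<in>S. of_real (c i * c j) *
        (of_real (\<alpha> n) * (of_real r * hinner (z i) (z j)) ^ n +
        of_real (\<beta> n) * cnj (of_real r * hinner (z i) (z j)) ^ n)) = (\<alpha> n + \<beta> n) * r ^ n * P n"
        unfolding P_def Re_sum * sum_distrib_left ..
    qed
    finally show ?thesis .
  qed
  show ?thesis
  proof (rule sums_le[OF _ sums sums])
    fix n
    have "r ^ n \<le> r' ^ n" using r by (intro power_mono) auto
    then show "(\<alpha> n + \<beta> n) * r ^ n * P n \<le> (\<alpha> n + \<beta> n) * r' ^ n * P n"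
      using P0 nonneg by (intro mult_right_mono mult_left_mono) auto
  qed (use r in auto)
qed

end

lemma kernel_radial_series:
  fixes K :: "complex ^ 'd \<Rightarrow> complex ^ 'd \<Rightarrow> complex"
  assumes "unitarily_invariant_pluriharmonic_space H ip K"
  obtains \<alpha> \<beta> where "radial_series \<alpha> \<beta>"
    "\<And>z w. z \<in> ball 0 1 \<Longrightarrow> w \<in> ball 0 1 \<Longrightarrow> K z w = radial_series.\<kappa> \<alpha> \<beta> (hinner z w)"
proof -
  obtain a :: "int \<Rightarrow> real" where *: "(\<forall>n. 0 \<le> a n) \<and> a 0 = 1 \<and>
        (\<forall>z\<in>ball 0 1. \<forall>w\<in>ball 0 1.
           summable (\<lambda>n. of_real (a (int n)) * hinner z w ^ n) \<and>
           summable (\<lambda>n. of_real (a (- int (Suc n))) * cnj (hinner z w) ^ Suc n) \<and>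
           K z w = (\<Sum>n. of_real (a (int n)) * hinner z w ^ n) +
                   (\<Sum>n. of_real (a (- int (Suc n))) * cnj (hinner z w) ^ Suc n))"
    using conjunct2[OF assms[unfolded unitarily_invariant_pluriharmonic_space_def]]
    by (elim exE) (erule that)
  from * have a: "0 \<le> a n" for n by (elim conjE) (erule spec)
  have *: "summable (\<lambda>n. of_real (a (int n)) * hinner z w ^ n) \<and>
      summable (\<lambda>n. of_real (a (- int (Suc n))) * cnj (hinner z w) ^ Suc n) \<and>
      K z w = (\<Sum>n. of_real (a (int n)) * hinner z w ^ n) +
              (\<Sum>n. of_real (a (- int (Suc n))) * cnj (hinner z w) ^ Suc n)"
    if "z \<in> ball 0 1" "w \<in> ball 0 1" for z w
    by (rule bspec[OF bspec[OF conjunct2[OF conjunct2[OF *]] that(1)] that(2)])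
  note s1 = *[THEN conjunct1] and s2 = *[THEN conjunct2, THEN conjunct1] and K = *[THEN conjunct2, THEN conjunct2]
  define \<alpha> where "\<alpha> n = a (int n)" for n
  \<comment> \<open>The antiholomorphic series starts at the first power, so the constant term
    \<open>a 0\<close> is counted in \<alpha> only.\<close>
  define \<beta> where "\<beta> n = (case n of 0 \<Rightarrow> 0 | Suc k \<Rightarrow> a (- int (Suc k)))" for n
  have s\<beta>: "summable (\<lambda>n. of_real (\<beta> n) * cnj (hinner z w) ^ n)"
    if "z \<in> ball 0 1" "w \<in> ball 0 1" for z w :: "complex ^ 'd"
    using s2[OF that] by (subst summable_Suc_iff[symmetric]) (simp add: \<beta>_def del: power_Suc of_nat_Suc)
  \<comment> \<open>Diagonal values of \<open>hinner\<close> fill [0,1). Convergence at such a value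
    above \<open>cmod t\<close> yields convergence at \<open>t\<close>, so the whole disc is covered
    in every dimension.\<close>
  have pt: "\<exists>z::complex ^ 'd. z \<in> ball 0 1 \<and> hinner z z = of_real \<rho>" if rho: "0 \<le> \<rho>" "\<rho> < 1" for \<rho>
  proof -
    obtain z :: "complex ^ 'd" where "norm z = sqrt \<rho>"
      by (rule vector_choose_size[of "sqrt \<rho>"]) (use rho in simp)
    then show ?thesis using that by (intro exI[of _ z]) (simp add: hinner_self)
  qed
  have rs: "radial_series \<alpha> \<beta>"
  proof
    fix n show "0 \<le> \<alpha> n" "0 \<le> \<beta> n" by (auto simp: \<alpha>_def \<beta>_def a split: nat.split)
  next
    fix t :: complex assume "cmod t < 1"
    then obtain \<rho> where \<rho>: "cmod t < \<rho>" "\<rho> < 1" using dense by blast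
    then have "0 \<le> \<rho>" by (meson le_less_trans less_imp_le norm_ge_zero)
    from pt[OF this \<rho>(2)] obtain z :: "complex ^ 'd" where z: "z \<in> ball 0 1" "hinner z z = of_real \<rho>" by blast
    have l: "norm t < norm (complex_of_real \<rho>)" using \<rho> by simp
    show "summable (\<lambda>n. of_real (\<alpha> n) * t ^ n)"
      by (rule powser_inside[OF _ l]) (use s1[OF z(1) z(1)] in \<open>simp add: z(2) \<alpha>_def\<close>)
    show "summable (\<lambda>n. of_real (\<beta> n) * t ^ n)"
      by (rule powser_inside[OF _ l]) (use s\<beta>[OF z(1) z(1)] in \<open>simp add: z(2)\<close>)
  qed
  moreover have "K z w = radial_series.\<kappa> \<alpha> \<beta> (hinner z w)" if "z \<in> ball 0 1" "w \<in> ball 0 1" for z w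
    using suminf_split_head[OF s\<beta>[OF that]]
    by (simp add: K[OF that] radial_series.\<kappa>_def[OF rs] \<alpha>_def \<beta>_def del: power_Suc of_nat_Suc)
  ultimately show thesis by (rule that)
qed

section \<open>Finitely supported measures: mixtures, potentials and energies\<close>

lemma mixture_with_point:
  assumes t: "0 \<le> t" "t \<le> 1"
  obtains q where "\<And>x. pmf q x = (1 - t) * pmf p x + t * indicator {y} x"
    "set_pmf q \<subseteq> insert y (set_pmf p)"
proof
  define q where "q = bind_pmf (bernoulli_pmf t) (\<lambda>b. if b then return_pmf y else p)"
  show "pmf q x = (1 - t) * pmf p x + t * indicator {y} x" for x
    using t unfolding q_def pmf_bind
    by (subst integral_measure_pmf[of UNIV]) (auto simp: UNIV_bool pmf_return indicator_def)
  show "set_pmf q \<subseteq> insert y (set_pmf p)"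
    by (auto simp: q_def split: if_splits)
qed

locale unitarily_invariant = rkhs "ball 0 1" H ip K + radial_series \<alpha> \<beta>
  for H :: "(complex ^ 'd \<Rightarrow> complex) set" and ip K \<alpha> \<beta> +
  assumes K_eq: "z \<in> ball 0 1 \<Longrightarrow> w \<in> ball 0 1 \<Longrightarrow> K z w = \<kappa> (hinner z w)"
begin

text \<open>The double integral of K(rz,rw); the square arises because both arguments are scaled. A
  sum over an infinite set is 0, so the value is meaningful for finite supports only.\<close>

definition pmf_energy :: "real \<Rightarrow> (complex ^ 'd) pmf \<Rightarrow> real" where
  "pmf_energy r p = Re (\<Sum>z\<in>set_pmf p. \<Sum>w\<in>set_pmf p.
     of_real (pmf p z * pmf p w) * \<kappa> (of_real (r\<^sup>2) * hinner z w))"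

text \<open>Only the integration variable is scaled, which makes this a finite combination of kernel
  functions and thus an element of \<open>H\<close>.\<close>

definition potential :: "real \<Rightarrow> (complex ^ 'd) pmf \<Rightarrow> complex ^ 'd \<Rightarrow> complex" where
  "potential r p = (\<lambda>x. \<Sum>w\<in>set_pmf p. of_real (pmf p w) * kernel_fun (r *\<^sub>R w) x)"

lemma scaleR_sphere_mem_ball:
  assumes "w \<in> sphere 0 1" "0 \<le> r" "r < 1"
  shows "r *\<^sub>R w \<in> ball (0 :: complex ^ 'd) 1"
  using assms by simp

lemma K_scaleR:
  assumes "z \<in> sphere 0 1" "w \<in> sphere 0 1" "0 \<le> r" "r < 1" "0 \<le> s" "s < 1"
  shows "K (r *\<^sub>R z) (s *\<^sub>R w) = \<kappa> (of_real (r * s) * hinner z w)"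
  using assms by (simp add: K_eq scaleR_sphere_mem_ball hinner_scaleR del: of_real_mult)

lemma potential_mem:
  assumes "set_pmf p \<subseteq> sphere 0 1" "0 \<le> r" "r < 1"
  shows "potential r p \<in> H"
  unfolding potential_def
  by (rule lincomb_mem) (use assms in \<open>auto intro!: kernel_fun_mem\<close>)

lemma potential_eq:
  assumes "set_pmf p \<subseteq> sphere 0 1" "0 \<le> r" "r < 1" "x \<in> ball 0 1"
  shows "potential r p x = (\<Sum>w\<in>set_pmf p. of_real (pmf p w) * \<kappa> (of_real r * hinner x w))"
  unfolding potential_def kernel_fun_def
  by (rule sum.cong) (use assms in \<open>auto simp: K_eq hinner_scaleR_right subset_iff\<close>)

text \<open>The reproducing property turns inner products of kernel functions into kernel values.
  Minimising the energy is therefore minimising a norm over a convex set in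
  \<open>H\<close>.\<close>

lemma ip_potential:
  assumes p: "set_pmf p \<subseteq> sphere 0 1" and r: "0 \<le> r" "r < 1"
  shows "Re (ip (potential r p) (potential r p)) = pmf_energy r p"
proof -
  have k: "kernel_fun (r *\<^sub>R w) \<in> H" if "w \<in> set_pmf p" for w
    using that p r by (auto intro!: kernel_fun_mem)
  have "ip (potential r p) (potential r p)
    = (\<Sum>w\<in>set_pmf p. of_real (pmf p w) * potential r p (r *\<^sub>R w))"
    by (subst (2) potential_def, subst ip_lincomb_right[OF k potential_mem[OF p r]])
       (use p r in \<open>auto intro!: sum.cong simp: reproducing[OF _ potential_mem[OF p r]]\<close>)
  also have "\<dots> = (\<Sum>w\<in>set_pmf p. \<Sum>z\<in>set_pmf p.
      of_real (pmf p w * pmf p z) * \<kappa> (of_real (r\<^sup>2) * hinner w z))"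
  proof (rule sum.cong[OF refl])
    fix w assume "w \<in> set_pmf p"
    then have "r *\<^sub>R w \<in> ball 0 1" using p r by (auto intro!: scaleR_sphere_mem_ball)
    from potential_eq[OF p r this]
    show "of_real (pmf p w) * potential r p (r *\<^sub>R w) = (\<Sum>z\<in>set_pmf p.
      of_real (pmf p w * pmf p z) * \<kappa> (of_real (r\<^sup>2) * hinner w z))"
      by (simp add: sum_distrib_left hinner_scaleR_left power2_eq_square mult_ac)
  qed
  finally show ?thesis unfolding pmf_energy_def by (rule arg_cong)
qed

lemma pmf_energy_mono:
  assumes "set_pmf p \<subseteq> sphere 0 1" "0 \<le> r" "r \<le> s" "s < 1"
  shows "pmf_energy r p \<le> pmf_energy s p"
  unfolding pmf_energy_def
  using \<kappa>_quadratic_form_mono[of "set_pmf p" "\<lambda>x. x" "r\<^sup>2" "s\<^sup>2" "pmf p"] assms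
  by (auto simp: subset_iff power_mono power_less_one_iff abs_square_less_1)

lemma pmf_energy_eq_integral:
  assumes "finite (set_pmf p)"
  shows "pmf_energy r p = Re (LINT z|p. LINT w|p. \<kappa> (of_real (r\<^sup>2) * hinner z w))"
  unfolding pmf_energy_def
  by (subst (1 2) integral_measure_pmf[OF assms])
     (auto simp: scaleR_conv_of_real sum_distrib_left mult_ac)

text \<open>\<open>K\<close> is prescribed on the ball only; there it is replaced by \<kappa>, which
  is Borel on the whole plane.\<close>

lemma energy_eq:
  assumes \<mu>: "sphere_probability_measure \<mu>" and r: "0 \<le> r" "r < 1"
  shows "(LINT z|\<mu>. LINT w|\<mu>. K (r *\<^sub>R z) (r *\<^sub>R w))
       = (LINT z|\<mu>. LINT w|\<mu>. \<kappa> (of_real (r\<^sup>2) * hinner z w))"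
proof -
  have sp: "space \<mu> = sphere 0 1"
    using sets_eq_imp_space_eq[of \<mu>] \<mu>
    by (auto simp: sphere_probability_measure_def space_restrict_space)
  show ?thesis
    by (intro Bochner_Integration.integral_cong refl)
       (use r in \<open>auto simp: sp K_scaleR power2_eq_square simp del: of_real_mult\<close>)
qed

end

subsection \<open>Energy\<close>

context radial_series
begin

text \<open>Dominated convergence twice, first in the inner variable for a fixed outer one. The
  arguments of \<kappa> stay in the closed disc of radius \<open>\<rho> < 1\<close>, where \<kappa>
  is continuous and bounded.\<close>

lemma double_integral_tendsto:
  fixes X :: "nat \<Rightarrow> 'a \<Rightarrow> complex ^ 'd"
  assumes \<Omega>: "prob_space \<Omega>" and \<rho>: "0 \<le> \<rho>" "\<rho> < 1"
    and [measurable]: "\<And>n. X n \<in> borel_measurable \<Omega>" "Z \<in> borel_measurable \<Omega>"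
    and X: "\<And>n \<omega>. \<omega> \<in> space \<Omega> \<Longrightarrow> norm (X n \<omega>) \<le> 1"
    and Z: "\<And>\<omega>. \<omega> \<in> space \<Omega> \<Longrightarrow> norm (Z \<omega>) \<le> 1"
    and lim: "\<And>\<omega>. \<omega> \<in> space \<Omega> \<Longrightarrow> (\<lambda>n. X n \<omega>) \<longlonglongrightarrow> Z \<omega>"
  shows "(\<lambda>n. LINT \<omega>|\<Omega>. LINT \<eta>|\<Omega>. \<kappa> (of_real \<rho> * hinner (X n \<omega>) (X n \<eta>)))
    \<longlonglongrightarrow> (LINT \<omega>|\<Omega>. LINT \<eta>|\<Omega>. \<kappa> (of_real \<rho> * hinner (Z \<omega>) (Z \<eta>)))"
proof -
  interpret prob_space \<Omega> by fact
  obtain B where B: "\<And>t. cmod t \<le> \<rho> \<Longrightarrow> cmod (\<kappa> t) \<le> B"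
    using \<kappa>_bounded[OF \<rho>(2)] by blast
  have le: "cmod (of_real \<rho> * hinner x y) \<le> \<rho>" if "norm x \<le> 1" "norm y \<le> 1" for x y :: "complex ^ 'd"
  proof -
    have "cmod (hinner x y) \<le> 1"
      using norm_hinner_le[of x y] mult_mono[OF that] by simp
    then show ?thesis using \<rho> by (simp add: norm_mult mult_left_le)
  qed
  have inner: "(\<lambda>n. LINT \<eta>|\<Omega>. \<kappa> (of_real \<rho> * hinner (X n \<omega>) (X n \<eta>)))
      \<longlonglongrightarrow> (LINT \<eta>|\<Omega>. \<kappa> (of_real \<rho> * hinner (Z \<omega>) (Z \<eta>)))" if \<omega>: "\<omega> \<in> space \<Omega>" for \<omega>
  proof (rule integral_dominated_convergence[where w = "\<lambda>_. B"])
    show "AE \<eta> in \<Omega>. (\<lambda>n. \<kappa> (of_real \<rho> * hinner (X n \<omega>) (X n \<eta>)))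
        \<longlonglongrightarrow> \<kappa> (of_real \<rho> * hinner (Z \<omega>) (Z \<eta>))"
    proof (rule AE_I2)
      fix \<eta> assume \<eta>: "\<eta> \<in> space \<Omega>"
      have "isCont \<kappa> (of_real \<rho> * hinner (Z \<omega>) (Z \<eta>))"
        using le[OF Z[OF \<omega>] Z[OF \<eta>]] \<rho>(2) by (intro isCont_\<kappa>) simp
      then show "(\<lambda>n. \<kappa> (of_real \<rho> * hinner (X n \<omega>) (X n \<eta>)))
          \<longlonglongrightarrow> \<kappa> (of_real \<rho> * hinner (Z \<omega>) (Z \<eta>))"
        by (rule isCont_tendsto_compose) (intro tendsto_intros lim \<omega> \<eta>)
    qed
    show "AE \<eta> in \<Omega>. norm (\<kappa> (of_real \<rho> * hinner (X n \<omega>) (X n \<eta>))) \<le> B" for n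
      by (rule AE_I2) (intro B le X \<omega>)
  qed (use \<omega> in measurable)
  show ?thesis
  proof (rule integral_dominated_convergence[where w = "\<lambda>_. B"])
    show "AE \<omega> in \<Omega>. (\<lambda>n. LINT \<eta>|\<Omega>. \<kappa> (of_real \<rho> * hinner (X n \<omega>) (X n \<eta>)))
      \<longlonglongrightarrow> (LINT \<eta>|\<Omega>. \<kappa> (of_real \<rho> * hinner (Z \<omega>) (Z \<eta>)))"
      by (rule AE_I2) (rule inner)
    show "AE \<omega> in \<Omega>. norm (LINT \<eta>|\<Omega>. \<kappa> (of_real \<rho> * hinner (X n \<omega>) (X n \<eta>))) \<le> B" for n
    proof (rule AE_I2)
      fix \<omega> assume \<omega>: "\<omega> \<in> space \<Omega>"
      have "norm (LINT \<eta>|\<Omega>. \<kappa> (of_real \<rho> * hinner (X n \<omega>) (X n \<eta>)))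
          \<le> (LINT \<eta>|\<Omega>. norm (\<kappa> (of_real \<rho> * hinner (X n \<omega>) (X n \<eta>))))"
        by (rule integral_norm_bound)
      also have "\<dots> \<le> (LINT \<eta>|\<Omega>. B)"
      proof (rule integral_mono')
        show "norm (\<kappa> (of_real \<rho> * hinner (X n \<omega>) (X n \<eta>))) \<le> B" if "\<eta> \<in> space \<Omega>" for \<eta>
          by (intro B le X \<omega> that)
        show "0 \<le> B" using order_trans[OF norm_ge_zero B[of 0]] \<rho>(1) by simp
      qed simp
      also have "\<dots> = B" by (simp add: prob_space)
      finally show "norm (LINT \<eta>|\<Omega>. \<kappa> (of_real \<rho> * hinner (X n \<omega>) (X n \<eta>))) \<le> B" .
    qed
  qed measurable
qed

text \<open>The target \<open>N\<close> is left open to cover both \<open>borel\<close> (with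
  \<open>S = UNIV\<close>) and the Borel sets of the sphere.\<close>

lemma double_integral_distr:
  fixes f :: "'a \<Rightarrow> complex ^ 'd"
  assumes \<mu>: "prob_space M" and f: "f \<in> measurable M N" and N: "sets N = sets (restrict_space borel S)"
  shows "(LINT z|distr M N f. LINT w|distr M N f. \<kappa> (of_real \<rho> * hinner z w))
    = (LINT x|M. LINT y|M. \<kappa> (of_real \<rho> * hinner (f x) (f y)))"
proof -
  have [measurable]: "(\<lambda>x. x) \<in> borel_measurable N"
    unfolding measurable_cong_sets[OF N refl]
    by (rule measurable_restrict_space1) simp
  note f[measurable]
  have fb[measurable]: "f \<in> borel_measurable M"
    using measurable_compose[OF f, of "\<lambda>x. x" borel] by simp
  interpret prob_space M by fact
  have "(LINT w|distr M N f. \<kappa> (of_real \<rho> * hinner z w)) = (LINT y|M. \<kappa> (of_real \<rho> * hinner z (f y)))" for z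
    by (rule integral_distr[OF f]) measurable
  then have "(LINT z|distr M N f. LINT w|distr M N f. \<kappa> (of_real \<rho> * hinner z w))
    = (LINT z|distr M N f. LINT y|M. \<kappa> (of_real \<rho> * hinner z (f y)))" by simp
  also have "\<dots> = (LINT x|M. LINT y|M. \<kappa> (of_real \<rho> * hinner (f x) (f y)))"
    by (rule integral_distr[OF f]) measurable
  finally show ?thesis .
qed

end

section \<open>Unbounded energies on sets of capacity zero\<close>

context unitarily_invariant
begin

text \<open>Zero capacity says that each single measure has infinite energy. Compactness improves
  this to one radius \<open>r\<close> that serves all finitely supported measures on
  \<open>E\<close> at once.\<close>

lemma pmf_energy_unbounded:
  assumes E: "compact E" "E \<subseteq> sphere 0 1" and cap: "capacity K E = 0"
  shows "\<exists>r. 0 \<le> r \<and> r < 1 \<and> (\<forall>p. finite (set_pmf p) \<and> set_pmf p \<subseteq> E \<longrightarrow> M < pmf_energy r p)"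
proof (rule ccontr)
  assume "\<not> ?thesis"
  then have "\<forall>r. \<exists>p. 0 \<le> r \<and> r < 1 \<longrightarrow> finite (set_pmf p) \<and> set_pmf p \<subseteq> E \<and> pmf_energy r p \<le> M"
    by (metis not_less)
  then obtain P where P: "\<And>r. 0 \<le> r \<Longrightarrow> r < 1 \<Longrightarrow>
      finite (set_pmf (P r)) \<and> set_pmf (P r) \<subseteq> E \<and> pmf_energy r (P r) \<le> M" by metis
  define r where "r n = 1 - 1 / real (n + 2)" for n
  have r: "0 \<le> r n" "r n < 1" for n by (auto simp: r_def field_simps)
  define p where "p n = P (r n)" for n
  have p: "finite (set_pmf (p n))" "set_pmf (p n) \<subseteq> E" "pmf_energy (r n) (p n) \<le> M" for n
    using P[OF r[of n]] by (auto simp: p_def)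
  have r_lim: "r \<longlonglongrightarrow> 1" unfolding r_def by real_asymp
  obtain \<phi> :: "nat \<Rightarrow> nat" and \<Omega> :: "real measure" and X Z where
    \<phi>: "strict_mono \<phi>" and \<Omega>: "prob_space \<Omega>"
    and X: "\<And>n. X n \<in> borel_measurable \<Omega>" and Z: "Z \<in> borel_measurable \<Omega>"
    and XE: "\<And>n \<omega>. \<omega> \<in> space \<Omega> \<Longrightarrow> X n \<omega> \<in> E" and ZE: "\<And>\<omega>. \<omega> \<in> space \<Omega> \<Longrightarrow> Z \<omega> \<in> E"
    and dX: "\<And>n. distr \<Omega> borel (X n) = distr (measure_pmf (p (\<phi> n))) borel (\<lambda>x. x)"
    and lim: "\<And>\<omega>. \<omega> \<in> space \<Omega> \<Longrightarrow> (\<lambda>n. X n \<omega>) \<longlonglongrightarrow> Z \<omega>"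
    by (rule Skorohod_compact[of E p, OF E(1) p(2)]) (rule that)
  let ?S = "restrict_space borel (sphere 0 1) :: (complex ^ 'd) measure"
  define \<mu> where "\<mu> = distr \<Omega> ?S Z"
  have Zm: "Z \<in> measurable \<Omega> ?S"
    using ZE E(2) Z by (auto intro!: measurable_restrict_space2)
  have \<mu>: "sphere_probability_measure \<mu>"
    unfolding sphere_probability_measure_def \<mu>_def
    by (auto intro!: prob_space.prob_space_distr[OF \<Omega>] Zm)
  have SE: "sphere 0 1 - E \<in> sets ?S"
    using E by (subst sets_restrict_space_iff) (auto simp: compact_imp_closed)
  have "Z -` (sphere 0 1 - E) \<inter> space \<Omega> = {}" using ZE by auto
  then have "emeasure \<mu> (sphere 0 1 - E) = 0"
    unfolding \<mu>_def by (subst emeasure_distr[OF Zm SE]) simp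
  with \<mu> have "1 / energy K \<mu> \<le> capacity K E"
    unfolding capacity_def by (intro SUP_upper) auto
  then have inf: "energy K \<mu> = \<infinity>"
    using cap by (simp add: ennreal_divide_eq_0_iff)
  have "Re (LINT z|\<mu>. LINT w|\<mu>. K (s *\<^sub>R z) (s *\<^sub>R w)) \<le> M" if s: "0 \<le> s" "s < 1" for s
  proof -
    have s2: "0 \<le> s\<^sup>2" "s\<^sup>2 < 1" using s by (auto simp: abs_square_less_1)
    have norm1: "norm x \<le> 1" if "x \<in> E" for x using that E(2) by auto
    let ?I = "\<lambda>Y. LINT \<omega>|\<Omega>. LINT \<eta>|\<Omega>. \<kappa> (of_real (s\<^sup>2) * hinner (Y \<omega>) (Y \<eta>))"
    have "(\<lambda>n. Re (?I (X n))) \<longlonglongrightarrow> Re (?I Z)"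
      by (intro tendsto_Re double_integral_tendsto[OF \<Omega> s2 X Z] norm1 XE ZE lim)
    \<comment> \<open>The double integral depends only on the law, and \<open>X n\<close> has the
      law of \<open>p (\<phi> n)\<close>.\<close>
    moreover have "Re (?I (X n)) = pmf_energy s (p (\<phi> n))" for n
    proof -
      have N: "sets borel = sets (restrict_space (borel :: (complex ^ 'd) measure) UNIV)"
        by (simp add: sets_restrict_space)
      have "(\<lambda>x. x) \<in> measurable (measure_pmf (p (\<phi> n))) borel" by simp
      then show ?thesis
        unfolding pmf_energy_eq_integral[OF p(1)]
          double_integral_distr[OF \<Omega> X[of n] N, symmetric] dX
        by (subst double_integral_distr[OF measure_pmf.prob_space_axioms _ N]) simp_all
    qed
    \<comment> \<open>The radius \<open>s\<close> stays fixed while \<open>n\<close> grows. As soon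
      as \<open>r (\<phi> n)\<close> exceeds \<open>s\<close>, monotonicity in the radius transfers
      the bound \<open>M\<close> from \<open>r (\<phi> n)\<close> to \<open>s\<close>.\<close>
    moreover have "\<forall>\<^sub>F n in sequentially. pmf_energy s (p (\<phi> n)) \<le> M"
    proof -
      have "\<forall>\<^sub>F n in sequentially. s < r (\<phi> n)"
        using order_tendstoD(1)[OF LIMSEQ_subseq_LIMSEQ[OF r_lim \<phi>] s(2)] by (simp add: comp_def)
      then show ?thesis
      proof eventually_elim
        case (elim n)
        have "pmf_energy s (p (\<phi> n)) \<le> pmf_energy (r (\<phi> n)) (p (\<phi> n))"
          using elim s p(2) E(2) r by (intro pmf_energy_mono) (blast, auto)
        with p(3)[of "\<phi> n"] show ?case by simp
      qed
    qed
    ultimately have "Re (?I Z) \<le> M"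
      by (intro tendsto_upperbound[of "\<lambda>n. Re (?I (X n))"]) auto
    also have "?I Z = (LINT z|\<mu>. LINT w|\<mu>. K (s *\<^sub>R z) (s *\<^sub>R w))"
      unfolding energy_eq[OF \<mu> s] unfolding \<mu>_def by (rule double_integral_distr[OF \<Omega> Zm, symmetric]) simp
    finally show ?thesis .
  qed
  then have "energy K \<mu> \<le> ennreal M"
    unfolding energy_def by (intro SUP_least ennreal_leI) auto
  with inf show False by (simp add: top_unique)
qed

end

subsection \<open>Functions with large radial limits\<close>

context unitarily_invariant
begin

lemma potential_mixture:
  assumes fin: "finite (set_pmf p)" and q: "\<And>x. pmf q x = (1 - t) * pmf p x + t * indicator {\<zeta>} x"
    and sub: "set_pmf q \<subseteq> insert \<zeta> (set_pmf p)"
  shows "potential r q = (\<lambda>x. of_real (1 - t) * potential r p x + of_real t * kernel_fun (r *\<^sub>R \<zeta>) x)"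
proof
  fix x
  let ?k = "\<lambda>w. kernel_fun (r *\<^sub>R w) x"
  let ?S = "insert \<zeta> (set_pmf p)"
  have S: "potential r p' x = (\<Sum>w\<in>?S. of_real (pmf p' w) * ?k w)" if "set_pmf p' \<subseteq> ?S" for p'
    unfolding potential_def
    by (rule sum.mono_neutral_left) (use fin that in \<open>auto simp: set_pmf_iff\<close>)
  have "potential r q x = (\<Sum>w\<in>?S. of_real (1 - t) * (of_real (pmf p w) * ?k w)) +
      (\<Sum>w\<in>?S. if w = \<zeta> then of_real t * ?k w else 0)"
    unfolding S[OF sub] sum.distrib[symmetric]
    by (rule sum.cong) (auto simp: q algebra_simps)
  also have "\<dots> = of_real (1 - t) * potential r p x + of_real t * ?k \<zeta>"
    unfolding sum_distrib_left[symmetric] S[OF subset_insertI, symmetric] using fin by simp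
  finally show "potential r q x = of_real (1 - t) * potential r p x + of_real t * ?k \<zeta>" .
qed

text \<open>Mixing \<open>p\<close> with the point mass at \<zeta> gives another competitor, so
  first-order optimality bounds the potential at \<open>r *\<^sub>R \<zeta>\<close> from below. The
  infimum \<open>c\<close> need not be attained, hence a near-minimiser.\<close>

lemma exists_large_potential:
  assumes E: "E \<subseteq> sphere 0 1" "E \<noteq> {}" and r: "0 \<le> r" "r < 1" and M: "1 \<le> M"
    and large: "\<And>p. finite (set_pmf p) \<Longrightarrow> set_pmf p \<subseteq> E \<Longrightarrow> M < pmf_energy r p"
  obtains p c where "finite (set_pmf p)" "set_pmf p \<subseteq> E" "M \<le> c" "pmf_energy r p \<le> 2 * c"
    "\<And>\<zeta>. \<zeta> \<in> E \<Longrightarrow> c / 2 \<le> Re (potential r p (r *\<^sub>R \<zeta>))"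
proof -
  define A where "A = {pmf_energy r p |p. finite (set_pmf p) \<and> set_pmf p \<subseteq> E}"
  define c where "c = Inf A"
  obtain e where "e \<in> E" using E by blast
  then have "pmf_energy r (return_pmf e) \<in> A" unfolding A_def by (intro CollectI exI[of _ "return_pmf e"]) auto
  then have A: "A \<noteq> {}" by blast
  have bdd: "bdd_below A" unfolding A_def using large by (intro bdd_belowI[of _ M]) (auto intro: less_imp_le)
  have Mc: "M \<le> c" unfolding c_def by (rule cInf_greatest[OF A]) (use large in \<open>auto simp: A_def intro: less_imp_le\<close>)
  have c_le: "c \<le> pmf_energy r p" if "finite (set_pmf p)" "set_pmf p \<subseteq> E" for p
    unfolding c_def by (rule cInf_lower[OF _ bdd]) (use that in \<open>auto simp: A_def\<close>)
  \<comment> \<open>\<open>B\<close> bounds the squared norms of all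
    \<open>kernel_fun (r *\<^sub>R \<zeta>)\<close> with \<zeta> in \<open>E\<close>, since
    \<open>hinner \<zeta> \<zeta> = 1\<close>. So \<open>t\<close> and then \<open>p\<close> can be
    fixed before \<zeta>; the summand 1 ensures \<open>t < 1\<close>.\<close>
  define B where "B = \<bar>Re (\<kappa> (of_real (r\<^sup>2)))\<bar> + 1"
  define t where "t = 1 / (2 * B)"
  have B: "1 \<le> B" by (simp add: B_def)
  then have t: "0 < t" "t * B \<le> 1 / 2" "t < 1" by (auto simp: t_def field_simps)
  have "\<exists>a\<in>A. a < c + t / 2"
    using cInf_lessD[OF A, of "c + t / 2"] t(1) by (simp add: c_def)
  then obtain p where p: "finite (set_pmf p)" "set_pmf p \<subseteq> E" "pmf_energy r p < c + t / 2"
    by (auto simp: A_def)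
  have ps: "set_pmf p \<subseteq> sphere 0 1" using p(2) E(1) by blast
  note pm = potential_mem[OF ps r]
  have "c / 2 \<le> Re (potential r p (r *\<^sub>R \<zeta>))" if \<zeta>: "\<zeta> \<in> E" for \<zeta>
  proof -
    have \<zeta>s: "\<zeta> \<in> sphere 0 1" using \<zeta> E(1) by blast
    note b = scaleR_sphere_mem_ball[OF \<zeta>s r]
    obtain q where q: "\<And>x. pmf q x = (1 - t) * pmf p x + t * indicator {\<zeta>} x"
        "set_pmf q \<subseteq> insert \<zeta> (set_pmf p)"
      using mixture_with_point[of t p \<zeta>] t by auto
    have q': "finite (set_pmf q)" "set_pmf q \<subseteq> E"
      using q(2) p \<zeta> by (auto dest: finite_subset)
    have "ip (kernel_fun (r *\<^sub>R \<zeta>)) (kernel_fun (r *\<^sub>R \<zeta>)) = K (r *\<^sub>R \<zeta>) (r *\<^sub>R \<zeta>)"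
      using reproducing[OF b kernel_fun_mem[OF b]] b by (simp add: kernel_fun_def)
    also have "\<dots> = \<kappa> (of_real (r\<^sup>2))"
      using K_scaleR[OF \<zeta>s \<zeta>s r r] \<zeta>s by (simp add: hinner_self power2_eq_square)
    finally have kB: "Re (ip (kernel_fun (r *\<^sub>R \<zeta>)) (kernel_fun (r *\<^sub>R \<zeta>))) \<le> B"
      by (simp add: B_def)
    have "c / 2 \<le> Re (ip (potential r p) (kernel_fun (r *\<^sub>R \<zeta>)))"
    proof (rule approximate_minimizer[OF pm kernel_fun_mem[OF b] t kB])
      show "1 \<le> c" using M Mc by simp
      show "c \<le> Re (ip (potential r p) (potential r p))"
        unfolding ip_potential[OF ps r] by (rule c_le[OF p(1,2)])
      show "Re (ip (potential r p) (potential r p)) \<le> c + t / 2"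
        unfolding ip_potential[OF ps r] using p(3) by simp
      have qs: "set_pmf q \<subseteq> sphere 0 1" using q'(2) E(1) by blast
      have "c \<le> Re (ip (potential r q) (potential r q))"
        unfolding ip_potential[OF qs r] by (rule c_le[OF q'])
      then show "c \<le> Re (ip
          (\<lambda>x. of_real (1 - t) * potential r p x + of_real t * kernel_fun (r *\<^sub>R \<zeta>) x)
          (\<lambda>x. of_real (1 - t) * potential r p x + of_real t * kernel_fun (r *\<^sub>R \<zeta>) x))"
        unfolding potential_mixture[OF p(1) q] .
    qed
    then show ?thesis by (simp add: reproducing[OF b pm])
  qed
  \<comment> \<open>Here \<open>c + t / 2 \<le> 2 * c\<close>, because
    \<open>t < 1 \<le> c\<close>.\<close>
  moreover have "pmf_energy r p \<le> 2 * c" using p(3) t(3) M Mc by simp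
  ultimately show thesis using that p(1,2) Mc by blast
qed

text \<open>The non-negative real part prevents cancellation when such functions are added. The
  bound 1/4 lies strictly below the lower bound 1/2 for the radial limit, so it holds for
  \<open>s\<close> near 1, how near depending on \<zeta>.\<close>

lemma exists_small_function:
  assumes E: "compact E" "E \<subseteq> sphere 0 1" "E \<noteq> {}" and cap: "capacity K E = 0"
    and K_pos: "\<And>z w. z \<in> ball 0 1 \<Longrightarrow> w \<in> ball 0 1 \<Longrightarrow> 0 \<le> Re (K z w)" and \<epsilon>: "0 < \<epsilon>"
  shows "\<exists>g\<in>H. norm_of g \<le> \<epsilon> \<and> (\<forall>z\<in>ball 0 1. 0 \<le> Re (g z)) \<and>
    (\<forall>\<zeta>\<in>E. \<forall>\<^sub>F s in at_left (1::real). 1 / 4 < Re (g (s *\<^sub>R \<zeta>)))"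
proof -
  \<comment> \<open>From \<open>c \<ge> M\<close> and squared norm at most \<open>2 * c\<close> for
    the potential, \<open>g\<close> has squared norm at most \<open>2 / c\<close>, hence at most the
    square of \<epsilon>.\<close>
  define M where "M = max 1 (2 / \<epsilon>\<^sup>2)"
  have M1: "1 \<le> M" by (simp add: M_def)
  obtain r where r: "0 \<le> r" "r < 1" and large: "\<And>p. finite (set_pmf p) \<Longrightarrow> set_pmf p \<subseteq> E \<Longrightarrow> M < pmf_energy r p"
    using pmf_energy_unbounded[OF E(1,2) cap, of M] by auto
  obtain p c where p: "finite (set_pmf p)" "set_pmf p \<subseteq> E" and c: "M \<le> c" "pmf_energy r p \<le> 2 * c"
    and lower: "\<And>\<zeta>. \<zeta> \<in> E \<Longrightarrow> c / 2 \<le> Re (potential r p (r *\<^sub>R \<zeta>))"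
    by (rule exists_large_potential[OF E(2,3) r M1 large]) (assumption+, rule that)
  have ps: "set_pmf p \<subseteq> sphere 0 1" using p(2) E(2) by blast
  have c1: "1 \<le> c" "2 / \<epsilon>\<^sup>2 \<le> c" using c(1) by (auto simp: M_def)
  have r2: "0 \<le> r\<^sup>2" "r\<^sup>2 < 1" "r\<^sup>2 \<le> r"
    using r by (auto simp: abs_square_less_1) (simp add: power2_eq_square mult_left_le)
  \<comment> \<open>Moving the poles from \<open>r *\<^sub>R w\<close> to radius r^2 lets the
    evaluation point move out to the sphere: the value at \<zeta> becomes that of
    \<open>potential r p\<close> at \<open>r *\<^sub>R \<zeta>\<close>. The energy at r^2 is at most
    that at \<open>r\<close>.\<close>
  let ?h = "potential (r\<^sup>2) p"
  define g where "g = (\<lambda>x. of_real (1 / c) * ?h x)"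
  note hm = potential_mem[OF ps r2(1,2)]
  have gm: "g \<in> H" unfolding g_def by (rule scale_mem[OF hm])
  have "(norm_of ?h)\<^sup>2 \<le> 2 * c"
    using pmf_energy_mono[OF ps r2(1,3) r(2)] c(2) by (simp add: norm_of_sq hm ip_potential[OF ps r2(1,2)])
  also have "\<dots> \<le> (\<epsilon> * c)\<^sup>2"
  proof -
    have "2 \<le> c * \<epsilon>\<^sup>2" using c1(2) \<epsilon> by (simp add: pos_divide_le_eq)
    then have "2 * c \<le> (c * \<epsilon>\<^sup>2) * c" using c1 by (intro mult_right_mono) auto
    then show ?thesis by (simp add: power2_eq_square mult_ac)
  qed
  finally have "norm_of ?h \<le> \<epsilon> * c" 
    by (rule power2_le_imp_le) (use \<epsilon> c1 in simp)
  moreover have "norm_of g = (1 / c) * norm_of ?h"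
    unfolding g_def norm_of_scale[OF hm] norm_of_real using c1 by simp
  ultimately have g_norm: "norm_of g \<le> \<epsilon>"
    using c1 by (simp add: pos_divide_le_eq)
  have pos: "0 \<le> Re (g z)" if z: "z \<in> ball 0 1" for z
  proof -
    have "0 \<le> Re (of_real (pmf p w) * kernel_fun (r\<^sup>2 *\<^sub>R w) z)" if "w \<in> set_pmf p" for w
    proof -
      have "r\<^sup>2 *\<^sub>R w \<in> ball 0 1" by (rule scaleR_sphere_mem_ball) (use ps that r2 in auto)
      from K_pos[OF z this] show ?thesis using z by (simp add: kernel_fun_def)
    qed
    then have "0 \<le> Re (?h z)" unfolding potential_def Re_sum by (rule sum_nonneg)
    then show ?thesis unfolding g_def Re_complex_of_real_mult using c1 by simp
  qed
  have lim: "\<forall>\<^sub>F s in at_left (1::real). 1 / 4 < Re (g (s *\<^sub>R \<zeta>))" if \<zeta>: "\<zeta> \<in> E" for \<zeta>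
  proof -
    have \<zeta>s: "\<zeta> \<in> sphere 0 1" using \<zeta> E(2) by blast
    let ?L = "\<Sum>w\<in>set_pmf p. of_real (pmf p w) * \<kappa> (of_real (r\<^sup>2) * hinner \<zeta> w)"
    have L: "?L = potential r p (r *\<^sub>R \<zeta>)"
      unfolding potential_eq[OF ps r scaleR_sphere_mem_ball[OF \<zeta>s r]]
      by (simp add: hinner_scaleR_left power2_eq_square mult_ac)
    have ev: "\<forall>\<^sub>F s in at_left (1::real). 0 < s \<and> s < 1"
      using eventually_at_left_real[of 0 1] by simp
    have "((\<lambda>s::real. \<Sum>w\<in>set_pmf p. of_real (pmf p w) * \<kappa> (of_real (r\<^sup>2) * hinner (s *\<^sub>R \<zeta>) w)) \<longlongrightarrow> ?L) (at_left 1)"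
    proof (intro tendsto_sum tendsto_mult tendsto_const)
      fix w assume "w \<in> set_pmf p"
      then have "norm w = 1" using ps by auto
      then have "cmod (hinner \<zeta> w) \<le> 1" using norm_hinner_le[of \<zeta> w] \<zeta>s by simp
      then have "cmod (of_real (r\<^sup>2) * hinner \<zeta> w) \<le> r\<^sup>2" using r2(1) by (simp add: norm_mult norm_power mult_left_le)
      then have "isCont \<kappa> (of_real (r\<^sup>2) * hinner (1 *\<^sub>R \<zeta>) w)" using r2(2) by (intro isCont_\<kappa>) simp
      then have "((\<lambda>s::real. \<kappa> (of_real (r\<^sup>2) * hinner (s *\<^sub>R \<zeta>) w)) \<longlongrightarrow> \<kappa> (of_real (r\<^sup>2) * hinner (1 *\<^sub>R \<zeta>) w)) (at_left 1)"
        by (rule isCont_tendsto_compose) (intro tendsto_intros)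
      then show "((\<lambda>s::real. \<kappa> (of_real (r\<^sup>2) * hinner (s *\<^sub>R \<zeta>) w)) \<longlongrightarrow> \<kappa> (of_real (r\<^sup>2) * hinner \<zeta> w)) (at_left 1)"
        by simp
    qed
    moreover have "\<forall>\<^sub>F s in at_left (1::real).
        (\<Sum>w\<in>set_pmf p. of_real (pmf p w) * \<kappa> (of_real (r\<^sup>2) * hinner (s *\<^sub>R \<zeta>) w)) = ?h (s *\<^sub>R \<zeta>)"
      using ev
    proof eventually_elim
      case (elim s)
      show ?case
        by (rule potential_eq[OF ps r2(1,2) scaleR_sphere_mem_ball[OF \<zeta>s], symmetric]) (use elim in auto)
    qed
    ultimately have "((\<lambda>s. ?h (s *\<^sub>R \<zeta>)) \<longlongrightarrow> ?L) (at_left (1::real))"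
      by (rule Lim_transform_eventually)
    then have "((\<lambda>s. Re (g (s *\<^sub>R \<zeta>))) \<longlongrightarrow> 1 / c * Re ?L) (at_left (1::real))"
      unfolding g_def Re_complex_of_real_mult by (intro tendsto_intros)
    moreover have "1 / 4 < 1 / c * Re ?L"
      using lower[OF \<zeta>] c1 unfolding L by (simp add: field_simps)
    ultimately show ?thesis by (rule order_tendstoD)
  qed
  show ?thesis
    by (intro bexI[OF _ gm] conjI ballI g_norm pos lim)
qed

end

section \<open>Summation of the small functions\<close>

theorem theorem3p4:
  fixes H :: "(complex ^ 'd \<Rightarrow> complex) set"
    and ip :: "(complex ^ 'd \<Rightarrow> complex) \<Rightarrow> (complex ^ 'd \<Rightarrow> complex) \<Rightarrow> complex"
    and K :: "complex ^ 'd \<Rightarrow> complex ^ 'd \<Rightarrow> complex"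
    and E :: "(complex ^ 'd) set"
  assumes "unitarily_invariant_pluriharmonic_space H ip K"
    and "\<And>z w. z \<in> ball 0 1 \<Longrightarrow> w \<in> ball 0 1 \<Longrightarrow> 0 \<le> Re (K z w)"
    and "compact E"
    and "E \<subseteq> sphere 0 1"
    and "capacity K E = 0"
  shows "\<exists>f\<in>H. \<forall>\<zeta>\<in>E. filterlim (\<lambda>r::real. cmod (f (r *\<^sub>R \<zeta>))) at_top (at_left 1)"
proof -
  have rk: "reproducing_kernel_hilbert_space (ball 0 1) H ip K"
    using assms(1) by (simp add: unitarily_invariant_pluriharmonic_space_def)
  obtain \<alpha> \<beta> where rs: "radial_series \<alpha> \<beta>" and Kk: "\<And>z w. z \<in> ball 0 1 \<Longrightarrow> w \<in> ball 0 1 \<Longrightarrow>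
      K z w = radial_series.\<kappa> \<alpha> \<beta> (hinner z w)"
    by (rule kernel_radial_series[OF assms(1)]) (rule that)
  interpret unitarily_invariant H ip K \<alpha> \<beta>
    unfolding unitarily_invariant_def rkhs_def unitarily_invariant_axioms_def
    using rk rs Kk by simp
  show ?thesis
  \<comment> \<open>The near-minimiser requires some measure on \<open>E\<close>; for empty
    \<open>E\<close> any element of \<open>H\<close> will do.\<close>
  proof (cases "E = {}")
    case True
    then show ?thesis using zero_mem by blast
  next
    case False
    have "\<forall>k::nat. \<exists>g. g \<in> H \<and> norm_of g \<le> (1/2) ^ k \<and> (\<forall>z\<in>ball 0 1. 0 \<le> Re (g z)) \<and>
      (\<forall>\<zeta>\<in>E. \<forall>\<^sub>F s in at_left (1::real). 1 / 4 < Re (g (s *\<^sub>R \<zeta>)))"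
      using exists_small_function[OF assms(3,4) False assms(5,2)] by (simp add: Bex_def)
    then obtain G where *: "\<forall>k. G k \<in> H \<and> norm_of (G k) \<le> (1/2) ^ k \<and> (\<forall>z\<in>ball 0 1. 0 \<le> Re (G k z)) \<and>
      (\<forall>\<zeta>\<in>E. \<forall>\<^sub>F s in at_left (1::real). 1 / 4 < Re (G k (s *\<^sub>R \<zeta>)))"
      by (rule exE[OF choice])
    then have G: "G k \<in> H" "norm_of (G k) \<le> (1/2) ^ k"
      "z \<in> ball 0 1 \<Longrightarrow> 0 \<le> Re (G k z)"
      "\<zeta> \<in> E \<Longrightarrow> \<forall>\<^sub>F s in at_left (1::real). 1 / 4 < Re (G k (s *\<^sub>R \<zeta>))" for k z \<zeta>
      by blast+
    have "summable (\<lambda>k. norm_of (G k))"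
      by (rule summable_comparison_test[OF _ summable_geometric[of "1/2::real"]])
         (use G(2) norm_of_nonneg[OF G(1)] in auto)
    from summable_series[OF G(1) this] obtain f where f: "f \<in> H"
      and sums: "\<And>x. x \<in> ball 0 1 \<Longrightarrow> (\<lambda>k. G k x) sums f x" by blast
    have "filterlim (\<lambda>r::real. cmod (f (r *\<^sub>R \<zeta>))) at_top (at_left 1)" if \<zeta>: "\<zeta> \<in> E" for \<zeta>
      unfolding filterlim_at_top
    proof
      fix Z :: real
      \<comment> \<open>The first \<open>N\<close> terms have real part above 1/4 each, so they
        reach \<open>Z\<close>. There are finitely many, so one left neighbourhood of 1 serves them
        all.\<close>
      obtain N :: nat where N: "4 * Z \<le> real N" using real_arch_simple by blast
      have "\<forall>\<^sub>F s in at_left (1::real). \<forall>k\<in>{..<N}. 1 / 4 < Re (G k (s *\<^sub>R \<zeta>))"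
        by (rule eventually_ball_finite) (use G(4)[OF \<zeta>] in auto)
      moreover have "\<forall>\<^sub>F s in at_left (1::real). s \<in> {0<..<1}"
        by (rule eventually_at_left_real) simp
      ultimately show "\<forall>\<^sub>F s in at_left (1::real). Z \<le> cmod (f (s *\<^sub>R \<zeta>))"
      proof eventually_elim
        case (elim s)
        have b: "s *\<^sub>R \<zeta> \<in> ball 0 1"
          by (rule scaleR_sphere_mem_ball) (use \<zeta> assms(4) elim in auto)
        have "Z \<le> (\<Sum>k<N. 1 / 4)" using N by simp
        also have "\<dots> \<le> (\<Sum>k<N. Re (G k (s *\<^sub>R \<zeta>)))"
          by (rule sum_mono) (use elim in \<open>auto intro: less_imp_le\<close>)
        \<comment> \<open>All further terms have non-negative real part on the ball, so a partial
          sum bounds the full series from below.\<close>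
        also have "\<dots> \<le> Re (f (s *\<^sub>R \<zeta>))"
          using sum_le_suminf[OF sums_summable[OF sums_Re[OF sums[OF b]]], of "{..<N}"] G(3)[OF b]
            sums_unique[OF sums_Re[OF sums[OF b]]] by simp
        also have "\<dots> \<le> cmod (f (s *\<^sub>R \<zeta>))" by (rule complex_Re_le_cmod)
        finally show ?case .
      qed
    qed
    with f show ?thesis by blast
  qed
qed

end
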